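(* Let $H$ be a connected non-trivial core graph with at least $3$ and at most $7$ vertices. Then $H$ is projective if and only if $H$ is indecomposable.
   Context: Graphs are finite, simple, undirected, loopless. A homomorphism $f:G\to H$ is a map $V_G\to V_H$ sending edges to edges. $H$ is a core if every homomorphism $H\to H$ is bijective. The cross (direct) product $G\times H$ has vertex set $V_G\times V_H$ and $((u_1,v_1),(u_2,v_2))$ is an edge iff $(u_1,u_2)\in E_G$ and $(v_1,v_2)\in E_H$; $H^m$ is the $m$-fold product. An $m$-ary polymorphism of $H$ is a homomorphism $H^m\to H$; it is idempotent if $f(x,\dots,x)=x$ for all $x$. $H$ is projective if every idempotent polymorphism of $H$ is a projection $(x_1,\dots,x_m)\mapsto x_i$. $H$ is decomposable if $H$ is isomorphic to $H_1\times H_2$ for non-trivial graphs $H_1,H_2$ (each with more than one vertex), and indecomposable otherwise. (This is the Okrasa–Rzążewski conjecture restricted to graphs on at most 7 vertices.) *)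

theory Defs
  imports "Graph_Theory.Graph_Theory"
begin

text \<open>
  A finite simple undirected loopless graph is a value of type \<^typ>\<open>'a pair_pre_digraph\<close>
  satisfying the locale predicate \<^const>\<open>pair_graph\<close>; an undirected edge is represented by
  its two arcs.
\<close>

definition nontrivial :: "'a pair_pre_digraph \<Rightarrow> bool" where
  "nontrivial G \<longleftrightarrow> card (pverts G) > 1"

definition graph_hom :: "'a pair_pre_digraph \<Rightarrow> 'b pair_pre_digraph \<Rightarrow> ('a \<Rightarrow> 'b) \<Rightarrow> bool" where
  "graph_hom G H f \<longleftrightarrow>
     (\<forall>u \<in> pverts G. f u \<in> pverts H) \<and> (\<forall>(u, v) \<in> parcs G. (f u, f v) \<in> parcs H)"

definition is_core :: "'a pair_pre_digraph \<Rightarrow> bool" where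
  "is_core H \<longleftrightarrow> (\<forall>f. graph_hom H H f \<longrightarrow> bij_betw f (pverts H) (pverts H))"

definition cross_prod ::
  "'a pair_pre_digraph \<Rightarrow> 'b pair_pre_digraph \<Rightarrow> ('a \<times> 'b) pair_pre_digraph" where
  "cross_prod G H =
     \<lparr> pverts = pverts G \<times> pverts H,
       parcs = {((u1, v1), (u2, v2)) | u1 v1 u2 v2. (u1, u2) \<in> parcs G \<and> (v1, v2) \<in> parcs H} \<rparr>"

text \<open>
  The vertices of the \<open>m\<close>-fold product are encoded as lists of length \<open>m\<close>; the lemmas
  \<open>cross_power_1_iso\<close> and \<open>cross_power_Suc_iso\<close> below relate this to iterating
  \<^const>\<open>cross_prod\<close>.
\<close>

definition cross_power :: "'a pair_pre_digraph \<Rightarrow> nat \<Rightarrow> 'a list pair_pre_digraph" where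
  "cross_power H m =
     \<lparr> pverts = {xs. length xs = m \<and> set xs \<subseteq> pverts H},
       parcs = {(xs, ys). length xs = m \<and> length ys = m \<and> (\<forall>i<m. (xs ! i, ys ! i) \<in> parcs H)} \<rparr>"

definition polymorphism :: "'a pair_pre_digraph \<Rightarrow> nat \<Rightarrow> ('a list \<Rightarrow> 'a) \<Rightarrow> bool" where
  "polymorphism H m f \<longleftrightarrow> graph_hom (cross_power H m) H f"

definition idempotent :: "'a pair_pre_digraph \<Rightarrow> nat \<Rightarrow> ('a list \<Rightarrow> 'a) \<Rightarrow> bool" where
  "idempotent H m f \<longleftrightarrow> (\<forall>x \<in> pverts H. f (replicate m x) = x)"

definition is_projection :: "'a pair_pre_digraph \<Rightarrow> nat \<Rightarrow> ('a list \<Rightarrow> 'a) \<Rightarrow> bool" where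
  "is_projection H m f \<longleftrightarrow> (\<exists>i<m. \<forall>xs \<in> pverts (cross_power H m). f xs = xs ! i)"

definition projective :: "'a pair_pre_digraph \<Rightarrow> bool" where
  "projective H \<longleftrightarrow>
     (\<forall>m\<ge>1. \<forall>f. polymorphism H m f \<and> idempotent H m f \<longrightarrow> is_projection H m f)"

text \<open>
  A definition cannot quantify over the vertex types of the factors. Since finite graphs can be
  relabelled, factors on natural numbers suffice: see \<open>decomposableI\<close> below.
\<close>

definition decomposable :: "'a pair_pre_digraph \<Rightarrow> bool" where
  "decomposable H \<longleftrightarrow>
     (\<exists>(H1 :: nat pair_pre_digraph) (H2 :: nat pair_pre_digraph).
        pair_graph H1 \<and> pair_graph H2 \<and> nontrivial H1 \<and> nontrivial H2 \<and>
        digraph_iso (with_proj H) (with_proj (cross_prod H1 H2)))"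

abbreviation indecomposable :: "'a pair_pre_digraph \<Rightarrow> bool" where
  "indecomposable H \<equiv> \<not> decomposable H"

lemma pair_digraph_iso_iff:
  assumes "pair_wf_digraph G"
  shows "digraph_iso (with_proj G) (with_proj H) \<longleftrightarrow>
    (\<exists>f. inj_on f (pverts G) \<and> pverts H = f ` pverts G \<and> parcs H = map_prod f f ` parcs G)"
    (is "?L \<longleftrightarrow> ?R")
proof
  interpret G: pair_wf_digraph G by fact
  assume ?L
  then obtain h where h: "pre_digraph.digraph_isomorphism (with_proj G) h"
    "with_proj H = app_iso h (with_proj G)"
    by (auto simp: digraph_iso_def)
  from h(2) have *: "pverts H = iso_verts h ` pverts G" "parcs H = iso_arcs h ` parcs G"
    "iso_tail h = fst" "iso_head h = snd"
    by (auto simp: with_proj_def app_iso_def)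
  have "iso_arcs h e = map_prod (iso_verts h) (iso_verts h) e" if "e \<in> parcs G" for e
    using h(1) that * by (auto simp: pre_digraph.digraph_isomorphism_def prod_eq_iff)
  then have "parcs H = map_prod (iso_verts h) (iso_verts h) ` parcs G"
    using * by simp
  then show ?R
    using * h(1) by (auto simp: pre_digraph.digraph_isomorphism_def)
next
  interpret G: pair_wf_digraph G by fact
  assume ?R
  then obtain f where f: "inj_on f (pverts G)" "pverts H = f ` pverts G"
    "parcs H = map_prod f f ` parcs G" by blast
  let ?h = "\<lparr>iso_verts = f, iso_arcs = map_prod f f, iso_head = snd, iso_tail = fst\<rparr>"
  have "inj_on (map_prod f f) (pverts G \<times> pverts G)"
    using f(1) by (simp add: map_prod_inj_on)
  moreover have "parcs G \<subseteq> pverts G \<times> pverts G"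
    by (auto dest: G.in_arcsD1 G.in_arcsD2)
  ultimately have "inj_on (map_prod f f) (parcs G)"
    by (rule inj_on_subset)
  then have "pre_digraph.digraph_isomorphism (with_proj G) ?h"
    using f(1) G.wf_digraph by (auto simp: pre_digraph.digraph_isomorphism_def)
  moreover have "with_proj H = app_iso ?h (with_proj G)"
    using f by (simp add: with_proj_def app_iso_def)
  ultimately show ?L
    unfolding digraph_iso_def by blast
qed

lemma pair_wf_digraph_cross_power:
  assumes "pair_wf_digraph H"
  shows "pair_wf_digraph (cross_power H m)"
proof -
  interpret pair_wf_digraph H by fact
  show ?thesis
  proof unfold_locales
    fix e assume "e \<in> parcs (cross_power H m)"
    then have *: "length (fst e) = m" "length (snd e) = m"
      "\<And>i. i < m \<Longrightarrow> (fst e ! i, snd e ! i) \<in> parcs H"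
      by (auto simp: cross_power_def)
    have "fst e ! i \<in> pverts H" "snd e ! i \<in> pverts H" if "i < m" for i
      using *(3)[OF that] by (blast dest: in_arcsD1 in_arcsD2)+
    with *(1,2) show "fst e \<in> pverts (cross_power H m)" "snd e \<in> pverts (cross_power H m)"
      by (auto simp: cross_power_def set_conv_nth)
  qed
qed

lemma cross_power_1_iso:
  assumes "pair_wf_digraph H"
  shows "digraph_iso (with_proj (cross_power H 1)) (with_proj H)"
proof -
  have "inj_on hd (pverts (cross_power H 1))"
    by (auto simp: inj_on_def cross_power_def length_Suc_conv)
  moreover have "pverts H = hd ` pverts (cross_power H 1)"
  proof (intro equalityI subsetI)
    fix v assume "v \<in> pverts H"
    then have "[v] \<in> pverts (cross_power H 1)" "v = hd [v]"
      by (auto simp: cross_power_def)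
    then show "v \<in> hd ` pverts (cross_power H 1)" by blast
  qed (auto simp: cross_power_def length_Suc_conv)
  moreover have "parcs H = map_prod hd hd ` parcs (cross_power H 1)"
  proof (intro equalityI subsetI)
    fix e assume "e \<in> parcs H"
    then have "([fst e], [snd e]) \<in> parcs (cross_power H 1)"
      "e = map_prod hd hd ([fst e], [snd e])"
      by (auto simp: cross_power_def)
    then show "e \<in> map_prod hd hd ` parcs (cross_power H 1)" by blast
  qed (auto simp: cross_power_def length_Suc_conv)
  ultimately show ?thesis
    unfolding pair_digraph_iso_iff[OF pair_wf_digraph_cross_power[OF assms]] by blast
qed

lemma cross_power_Suc_iso:
  assumes "pair_wf_digraph H"
  shows "digraph_iso (with_proj (cross_power H (Suc m)))
    (with_proj (cross_prod H (cross_power H m)))"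
proof -
  let ?f = "\<lambda>xs :: 'a list. (hd xs, tl xs)"
  let ?P = "cross_power H (Suc m)" and ?Q = "cross_prod H (cross_power H m)"
  have "inj_on ?f (pverts ?P)"
    by (rule inj_onI) (auto simp: cross_power_def intro: list.expand)
  moreover have "pverts ?Q = ?f ` pverts ?P"
  proof (intro equalityI subsetI)
    fix p assume "p \<in> pverts ?Q"
    then have "fst p # snd p \<in> pverts ?P" "p = ?f (fst p # snd p)"
      by (auto simp: cross_power_def cross_prod_def)
    then show "p \<in> ?f ` pverts ?P" by blast
  next
    fix p assume "p \<in> ?f ` pverts ?P"
    then obtain xs where xs: "p = ?f xs" "xs \<in> pverts ?P" by blast
    then obtain u us where "xs = u # us" by (cases xs) (auto simp: cross_power_def)
    with xs show "p \<in> pverts ?Q" by (auto simp: cross_power_def cross_prod_def)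
  qed
  moreover have "parcs ?Q = map_prod ?f ?f ` parcs ?P"
  proof (intro equalityI subsetI)
    fix e assume "e \<in> parcs ?Q"
    then obtain u xs v ys where e: "e = ((u, xs), (v, ys))" "(u, v) \<in> parcs H"
      "(xs, ys) \<in> parcs (cross_power H m)"
      by (auto simp: cross_prod_def)
    then have "(u # xs, v # ys) \<in> parcs ?P"
      by (auto simp: cross_power_def nth_Cons split: nat.split)
    moreover have "e = map_prod ?f ?f (u # xs, v # ys)" using e by simp
    ultimately show "e \<in> map_prod ?f ?f ` parcs ?P" by blast
  next
    fix e assume "e \<in> map_prod ?f ?f ` parcs ?P"
    then obtain xs ys where e: "e = (?f xs, ?f ys)" "(xs, ys) \<in> parcs ?P" by auto
    then obtain u us v vs where "xs = u # us" "ys = v # vs"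
      by (cases xs; cases ys) (auto simp: cross_power_def)
    with e show "e \<in> parcs ?Q"
      by (auto simp: cross_power_def cross_prod_def All_less_Suc2)
  qed
  ultimately show ?thesis
    unfolding pair_digraph_iso_iff[OF pair_wf_digraph_cross_power[OF assms]] by blast
qed

lemma pair_graph_relabel_nat:
  fixes G :: "'a pair_pre_digraph"
  assumes "pair_graph G"
  obtains f :: "'a \<Rightarrow> nat" and G' where "inj_on f (pverts G)" "pair_graph G'"
    "pverts G' = f ` pverts G" "parcs G' = map_prod f f ` parcs G"
proof -
  interpret pair_graph G by fact
  obtain f :: "'a \<Rightarrow> nat" where f: "inj_on f (pverts G)"
    using finite_imp_inj_to_nat_seg[OF pair_finite_verts] by blast
  let ?G = "\<lparr>pverts = f ` pverts G, parcs = map_prod f f ` parcs G\<rparr>"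
  have "pair_graph ?G"
  proof unfold_locales
    show "symmetric (with_proj ?G)"
    proof (unfold symmetric_def, rule symI)
      fix a b assume "(a, b) \<in> arcs_ends (with_proj ?G)"
      then obtain u v where uv: "(u, v) \<in> parcs G" "a = f u" "b = f v" by auto
      then have "(v, u) \<in> parcs G"
        using pair_sym_arcs by (auto simp: symmetric_def dest: symD)
      then have "map_prod f f (v, u) \<in> map_prod f f ` parcs G" by (rule imageI)
      with uv show "(b, a) \<in> arcs_ends (with_proj ?G)" by simp
    qed
  next
    fix e assume "e \<in> parcs ?G"
    then obtain u v where uv: "(u, v) \<in> parcs G" "e = (f u, f v)" by auto
    then have "u \<noteq> v" "u \<in> pverts G" "v \<in> pverts G"
      using pair_no_loops[of "(u, v)"] by (auto dest: in_arcsD1 in_arcsD2)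
    then show "fst e \<noteq> snd e"
      using f uv by (auto dest: inj_onD)
  qed (auto simp: pair_finite_verts pair_finite_arcs dest: in_arcsD1 in_arcsD2)
  with f show thesis by (intro that[of f ?G]) auto
qed

lemma decomposableI:
  fixes H :: "'a pair_pre_digraph" and H1 :: "'b pair_pre_digraph" and H2 :: "'c pair_pre_digraph"
  assumes "pair_wf_digraph H" "pair_graph H1" "pair_graph H2" "nontrivial H1" "nontrivial H2"
    and "digraph_iso (with_proj H) (with_proj (cross_prod H1 H2))"
  shows "decomposable H"
proof -
  from assms(1,6) obtain h where h: "inj_on h (pverts H)"
    "pverts (cross_prod H1 H2) = h ` pverts H" "parcs (cross_prod H1 H2) = map_prod h h ` parcs H"
    by (auto simp: pair_digraph_iso_iff)
  obtain f :: "'b \<Rightarrow> nat" and G1 where f: "inj_on f (pverts H1)" "pair_graph G1"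
    "pverts G1 = f ` pverts H1" "parcs G1 = map_prod f f ` parcs H1"
    using pair_graph_relabel_nat[OF assms(2)] .
  obtain g :: "'c \<Rightarrow> nat" and G2 where g: "inj_on g (pverts H2)" "pair_graph G2"
    "pverts G2 = g ` pverts H2" "parcs G2 = map_prod g g ` parcs H2"
    using pair_graph_relabel_nat[OF assms(3)] .
  let ?k = "map_prod f g"
  have "inj_on ?k (pverts (cross_prod H1 H2))"
    using f(1) g(1) by (simp add: cross_prod_def map_prod_inj_on)
  then have "inj_on (?k \<circ> h) (pverts H)"
    using h by (intro comp_inj_on) simp_all
  moreover have "pverts (cross_prod G1 G2) = ?k ` pverts (cross_prod H1 H2)"
    using f(3) g(3) by (auto simp: cross_prod_def)
  then have "pverts (cross_prod G1 G2) = (?k \<circ> h) ` pverts H"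
    using h(2) by (simp add: image_comp)
  moreover have "parcs (cross_prod G1 G2) = map_prod ?k ?k ` parcs (cross_prod H1 H2)"
  proof (intro equalityI subsetI)
    fix e assume "e \<in> parcs (cross_prod G1 G2)"
    then obtain a b c d where
      *: "e = ((f a, g c), (f b, g d))" "(a, b) \<in> parcs H1" "(c, d) \<in> parcs H2"
      using f(4) g(4) by (auto simp: cross_prod_def)
    then have "((a, c), (b, d)) \<in> parcs (cross_prod H1 H2)"
      "e = map_prod ?k ?k ((a, c), (b, d))"
      by (auto simp: cross_prod_def)
    then show "e \<in> map_prod ?k ?k ` parcs (cross_prod H1 H2)" by blast
  next
    fix e assume "e \<in> map_prod ?k ?k ` parcs (cross_prod H1 H2)"
    then obtain a b c d where
      *: "e = ((f a, g c), (f b, g d))" "(a, b) \<in> parcs H1" "(c, d) \<in> parcs H2"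
      by (auto simp: cross_prod_def)
    then have "(f a, f b) \<in> parcs G1" "(g c, g d) \<in> parcs G2"
      using f(4) g(4) map_prod_imageI by metis+
    with * show "e \<in> parcs (cross_prod G1 G2)" by (auto simp: cross_prod_def)
  qed
  then have "parcs (cross_prod G1 G2) = map_prod (?k \<circ> h) (?k \<circ> h) ` parcs H"
    using h(3) by (simp add: image_comp map_prod.comp)
  ultimately have "digraph_iso (with_proj H) (with_proj (cross_prod G1 G2))"
    using assms(1) pair_digraph_iso_iff by blast
  moreover have "nontrivial G1" "nontrivial G2"
    using assms(4,5) f g by (simp_all add: nontrivial_def card_image)
  ultimately show ?thesis
    using f(2) g(2) unfolding decomposable_def by blast
qed

end

theory Submission
  imports Defs "HOL-Library.List_Lexorder"
begin

text \<open>
  A connected core with at least three vertices is not bipartite. A product with fewer than nine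
  vertices has a factor with two vertices and is therefore bipartite, so every graph in question
  is indecomposable, and it remains to show that it is projective.

  In a connected non-bipartite graph without proper inclusions between neighbourhoods it suffices
  to consider binary polymorphisms. Identifying variables in a polymorphism of higher arity gives
  projections; by a lemma of Swierczkowski it is then a semiprojection, or it is ternary and a
  majority or, up to a permutation of the variables, a Maltsev operation. A semiprojection is a
  projection because any two vertices are joined by a walk of even length. A Maltsev operation
  forces all neighbourhoods to have one element. For a majority operation let \<open>g\<close> be the odd girth:
  joining vertices by walks of length \<open>g - 2\<close> gives a loopless graph with a triangle, preserved by
  the operation, which would extend every clique with at least three vertices.

  The binary polymorphisms are dealt with by a verified certificate checker. Among all numberings
  of the vertices the one with the lexicographically largest adjacency code is chosen. A
  decision tree on the edges then closes each branch by a larger code, by a non-injective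
  endomorphism, or, for the 16 remaining graphs, by an exhaustive search for the idempotent
  binary polymorphisms.
\<close>

section \<open>Certificates\<close>

text \<open>The pairs among the first \<open>k\<close> vertices form a prefix of this list. A
  lexicographic comparison of adjacency codes can thus be settled by a small induced subgraph while
  later edges are still undecided.\<close>

definition vertex_pairs :: "nat \<Rightarrow> (nat \<times> nat) list" where
  "vertex_pairs n = concat (map (\<lambda>j. map (\<lambda>i. (i, j)) [0..<j]) [0..<n])"

text \<open>
  A triple \<open>(x, y, v)\<close> in \<open>M\<close> stands for the assignment \<open>f x y = v\<close> in a partial homomorphism \<open>f\<close> from
  the square of the graph with adjacency matrix \<open>T\<close>.
\<close>

definition candidates ::
  "bool list list \<Rightarrow> nat \<Rightarrow> nat \<Rightarrow> (nat \<times> nat \<times> nat) list \<Rightarrow> nat list" where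
  "candidates T x y M =
     (let ws = map (\<lambda>(a, b, w). w) (filter (\<lambda>(a, b, w). T ! a ! x \<and> T ! b ! y) M)
      in filter (\<lambda>v. list_all (\<lambda>w. T ! w ! v) ws) [0..<length T])"

text \<open>Breadth-first: \<open>Ms\<close> holds every partial map on the pairs treated so far
  that passed the local tests; a map without candidate values disappears. The order of the pairs
  determines how many maps are alive at a time.\<close>

primrec search ::
  "bool list list \<Rightarrow> (nat \<times> nat) list \<Rightarrow> (nat \<times> nat \<times> nat) list list \<Rightarrow> bool" where
  "search T [] Ms \<longleftrightarrow>
     list_all (\<lambda>M. list_all (\<lambda>(x, y, v). v = x) M \<or> list_all (\<lambda>(x, y, v). v = y) M) Ms"
| "search T (p # ps) Ms \<longleftrightarrow>
     search T ps (concat (map (\<lambda>M.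
       map (\<lambda>v. (fst p, snd p, v) # M) (candidates T (fst p) (snd p) M)) Ms))"

text \<open>
  The known edges and non-edges of a graph are listed in \<open>yes\<close> and \<open>no\<close>.
  \<open>Endo f\<close> refutes a partially known graph by the non-injective endomorphism \<open>f\<close>, \<open>Relabel p\<close> by a
  renumbering \<open>p\<close> with a larger adjacency code; \<open>Rigid ps\<close> proves that a completely known graph has
  no binary idempotent polymorphism but the projections, by assigning the values in the order \<open>ps\<close>.
\<close>

datatype core_cert =
    Split nat nat core_cert core_cert
  | Endo "nat list"
  | Relabel "nat list"
  | Rigid "(nat \<times> nat) list"

text \<open>Success means a known edge at the renumbered pair over a known non-edge at
  \<open>e\<close>, after positions where equality is certain. A pair that \<open>p\<close> maps to
  itself is certain without being known. The empty list yields \<open>False\<close> because equal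
  codes are no gain.\<close>

primrec relabel_greater ::
  "nat list \<Rightarrow> (nat \<times> nat) list \<Rightarrow> (nat \<times> nat) list \<Rightarrow> (nat \<times> nat) list \<Rightarrow> bool" where
  "relabel_greater p yes no [] \<longleftrightarrow> False"
| "relabel_greater p yes no (e # es) \<longleftrightarrow>
     (let i = p ! fst e; j = p ! snd e in
      if (i, j) \<in> set yes then e \<in> set no \<or> e \<in> set yes \<and> relabel_greater p yes no es
      else ((i, j) \<in> set no \<and> e \<in> set no \<or> (i, j) = e \<or> (j, i) = e)
        \<and> relabel_greater p yes no es)"

text \<open>\<open>Split\<close> records both orientations of a decided pair, so that images of
  pairs can be looked up in either order. \<open>Endo\<close> also accepts an undecided pair that
  \<open>f\<close> maps to itself. The search of \<open>Rigid\<close> starts from the diagonal,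
  which encodes idempotence.\<close>

primrec check_core :: "nat \<Rightarrow> core_cert \<Rightarrow> (nat \<times> nat) list \<Rightarrow> (nat \<times> nat) list \<Rightarrow> bool" where
  "check_core n (Split i j c d) yes no \<longleftrightarrow>
     check_core n c ((i, j) # (j, i) # yes) no \<and> check_core n d yes ((i, j) # (j, i) # no)"
| "check_core n (Endo f) yes no \<longleftrightarrow>
     length f = n \<and> list_all (\<lambda>i. i < n) f \<and> \<not> distinct f \<and>
     list_all (\<lambda>(i, j). let e = (f ! i, f ! j) in
       e = (i, j) \<or> e = (j, i) \<or> (i, j) \<in> set no \<or> e \<in> set yes) (vertex_pairs n)"
| "check_core n (Relabel p) yes no \<longleftrightarrow>
     length p = n \<and> list_all (\<lambda>i. i < n) p \<and> distinct p \<and>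
     relabel_greater p yes no (vertex_pairs n)"
| "check_core n (Rigid ps) yes no \<longleftrightarrow>
     list_all (\<lambda>(i, j). (i, j) \<in> set yes \<or> (i, j) \<in> set no) (vertex_pairs n) \<and>
     list_all (\<lambda>(i, j). (i, j) \<in> set ps \<and> (j, i) \<in> set ps) (vertex_pairs n) \<and>
     list_all (\<lambda>(x, y). x < n \<and> y < n) ps \<and>
     search (map (\<lambda>i. map (\<lambda>j. (i, j) \<in> set yes \<or> (j, i) \<in> set yes) [0..<n]) [0..<n]) ps
       [map (\<lambda>i. (i, i, i)) [0..<n]]"

subsection \<open>Soundness\<close>

lemma set_vertex_pairs: "set (vertex_pairs n) = {(i, j). i < j \<and> j < n}"
  by (auto simp: vertex_pairs_def)

text \<open>The upper triangle of the adjacency matrix, column by column. Codes are compared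
  lexicographically with \<open>False < True\<close>, so the largest one places edges as early as
  possible.\<close>

definition adj_code :: "nat \<Rightarrow> (nat \<Rightarrow> nat \<Rightarrow> bool) \<Rightarrow> bool list" where
  "adj_code n A = map (\<lambda>(i, j). A i j) (vertex_pairs n)"

text \<open>The axiom \<open>maximal\<close> breaks the symmetry under renumbering: a branch of the
  decision tree in which some renumbering has a larger code is impossible. In \<open>core\<close>,
  injectivity on the finite set \<open>{..<n}\<close> amounts to bijectivity.\<close>

locale canonical_core =
  fixes n :: nat and A :: "nat \<Rightarrow> nat \<Rightarrow> bool"
  assumes sym: "A i j \<Longrightarrow> A j i"
    and irrefl: "\<not> A i i"
    and core: "\<lbrakk>\<And>i. i < n \<Longrightarrow> f i < n; \<And>i j. \<lbrakk>i < n; j < n; A i j\<rbrakk> \<Longrightarrow> A (f i) (f j)\<rbrakk>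
      \<Longrightarrow> inj_on f {..<n}"
    and maximal: "bij_betw p {..<n} {..<n} \<Longrightarrow> adj_code n (\<lambda>i j. A (p i) (p j)) \<le> adj_code n A"
begin

text \<open>The binary case of projectivity, transported to indices.\<close>

definition binary_rigid :: bool where
  "binary_rigid \<longleftrightarrow> (\<forall>f.
     (\<forall>x<n. \<forall>y<n. f x y < n) \<and> (\<forall>x<n. f x x = x) \<and>
     (\<forall>a<n. \<forall>b<n. \<forall>x<n. \<forall>y<n. A a x \<and> A b y \<longrightarrow> A (f a b) (f x y)) \<longrightarrow>
     (\<forall>x<n. \<forall>y<n. f x y = x) \<or> (\<forall>x<n. \<forall>y<n. f x y = y))"

definition consistent :: "(nat \<times> nat) list \<Rightarrow> (nat \<times> nat) list \<Rightarrow> bool" where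
  "consistent yes no \<longleftrightarrow> (\<forall>(i, j) \<in> set yes. A i j) \<and> (\<forall>(i, j) \<in> set no. \<not> A i j)"

text \<open>The restriction of the actual map \<open>f\<close> to the pairs treated so far survives
  every round, hence it is among the maps inspected at the end.\<close>

lemma search_sound:
  assumes T: "length T = n" "\<And>i j. \<lbrakk>i < n; j < n\<rbrakk> \<Longrightarrow> T ! i ! j = A i j"
    and f: "\<And>x y. \<lbrakk>x < n; y < n\<rbrakk> \<Longrightarrow> f x y < n"
      "\<And>a b x y. \<lbrakk>a < n; b < n; x < n; y < n; A a x; A b y\<rbrakk> \<Longrightarrow> A (f a b) (f x y)"
    and "search T ps Ms"
    and "\<forall>(x, y) \<in> set ps. x < n \<and> y < n"
    and "M \<in> set Ms" "\<forall>(a, b, w) \<in> set M. a < n \<and> b < n \<and> w = f a b"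
  shows "(\<forall>(x, y) \<in> set ps. f x y = x) \<or> (\<forall>(x, y) \<in> set ps. f x y = y)"
proof -
  \<comment> \<open>The claim covers \<open>M\<close> too: the induction moves pairs from
    \<open>ps\<close> into \<open>M\<close>, and the same projection must fit both.\<close>
  have "(\<forall>(x, y) \<in> set ps. f x y = x) \<and> (\<forall>(a, b, w) \<in> set M. w = a) \<or>
        (\<forall>(x, y) \<in> set ps. f x y = y) \<and> (\<forall>(a, b, w) \<in> set M. w = b)"
    using assms(5-8)
  proof (induction ps arbitrary: Ms M)
    case Nil
    then show ?case by (auto simp: list_all_iff)
  next
    case (Cons p ps)
    obtain x y where p: "p = (x, y)" by fastforce
    have xy: "x < n" "y < n" using Cons.prems(2) p by auto
    let ?M = "(x, y, f x y) # M"
    let ?Ms = "concat (map (\<lambda>M. map (\<lambda>v. (x, y, v) # M) (candidates T x y M)) Ms)"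
    \<comment> \<open>As \<open>f\<close> is a homomorphism, \<open>f x y\<close> is adjacent to
      each value in \<open>M\<close> at a neighbour of \<open>(x, y)\<close> in the square.\<close>
    have "f x y \<in> set (candidates T x y M)"
      using Cons.prems(4) xy f by (fastforce simp: candidates_def list_all_iff T)
    then have "?M \<in> set ?Ms"
      using Cons.prems(3) by auto
    moreover have "search T ps ?Ms"
      using Cons.prems(1) p by simp
    ultimately show ?case
      using Cons.IH[of ?Ms ?M] Cons.prems xy p by auto
  qed
  then show ?thesis by blast
qed

text \<open>Each verdict rests on known pairs or on a pair compared with itself, so it is valid in
  every graph that fits \<open>yes\<close> and \<open>no\<close>.\<close>

lemma relabel_greater_sound:
  assumes "relabel_greater p yes no es" "consistent yes no"
  shows "map (\<lambda>(i, j). A i j) es < map (\<lambda>(i, j). A (p ! i) (p ! j)) es"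
  using assms(1)
proof (induction es)
  case (Cons e es)
  obtain i j where e: "e = (i, j)" by fastforce
  show ?case
    using Cons assms(2) sym
    by (auto simp: e consistent_def Let_def less_bool_def split: if_splits)
qed simp

text \<open>A \<open>Split\<close> is a case distinction on one edge. Leaves \<open>Endo\<close> and
  \<open>Relabel\<close> contradict \<open>core\<close> and \<open>maximal\<close>, so the goal
  follows there from falsity; only \<open>Rigid\<close> establishes it directly.\<close>

lemma check_core_sound:
  assumes "check_core n c yes no" "consistent yes no"
  shows binary_rigid
  using assms
proof (induction c arbitrary: yes no)
  case (Split i j c d)
  show ?case
  proof (cases "A i j")
    case True
    then have "consistent ((i, j) # (j, i) # yes) no"
      using Split.prems(2) sym by (auto simp: consistent_def)
    then show ?thesis using Split by auto
  next
    case False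
    then have "consistent yes ((i, j) # (j, i) # no)"
      using Split.prems(2) sym by (auto simp: consistent_def)
    then show ?thesis using Split by auto
  qed
next
  case (Endo f)
  then have f: "length f = n" "\<And>i. i < n \<Longrightarrow> f ! i < n" "\<not> distinct f"
    by (auto simp: list_all_length)
  \<comment> \<open>The certificate is tested for \<open>i < j\<close>; symmetry of \<open>A\<close>
    gives the other pairs.\<close>
  have less: "A (f ! i) (f ! j)" if "i < j" "j < n" "A i j" for i j
    using Endo that sym
    by (fastforce simp: list_all_iff set_vertex_pairs consistent_def Let_def)
  have "A (f ! i) (f ! j)" if "i < n" "j < n" "A i j" for i j
    using less[of i j] less[of j i] that sym irrefl by (metis linorder_neqE_nat)
  then have "inj_on ((!) f) {..<n}"
    using f(2) by (intro core)
  then show ?case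
    using f(1,3) by (auto simp: distinct_conv_nth inj_on_def)
next
  case (Relabel p)
  then have p: "length p = n" "\<And>i. i < n \<Longrightarrow> p ! i < n" "distinct p"
    by (auto simp: list_all_length)
  have "inj_on ((!) p) {..<n}"
    using p(1,3) by (auto simp: inj_on_def nth_eq_iff_index_eq)
  moreover have "(!) p ` {..<n} \<subseteq> {..<n}"
    using p(2) by auto
  ultimately have "bij_betw ((!) p) {..<n} {..<n}"
    by (simp add: bij_betw_def endo_inj_surj)
  then have "adj_code n (\<lambda>i j. A (p ! i) (p ! j)) \<le> adj_code n A"
    by (rule maximal)
  moreover have "adj_code n A < adj_code n (\<lambda>i j. A (p ! i) (p ! j))"
    using relabel_greater_sound[of p yes no "vertex_pairs n"] Relabel by (simp add: adj_code_def)
  ultimately show ?case by simp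
next
  case (Rigid ps)
  let ?T = "map (\<lambda>i. map (\<lambda>j. (i, j) \<in> set yes \<or> (j, i) \<in> set yes) [0..<n]) [0..<n]"
  let ?M = "map (\<lambda>i. (i, i, i)) [0..<n]"
  have less: "A i j \<longleftrightarrow> (i, j) \<in> set yes \<or> (j, i) \<in> set yes" if "i < j" "j < n" for i j
    using Rigid that sym by (fastforce simp: list_all_iff set_vertex_pairs consistent_def)
  have T: "?T ! i ! j = A i j" if "i < n" "j < n" for i j
  proof (cases i j rule: linorder_cases)
    case equal
    \<comment> \<open>By consistency with the irreflexive \<open>A\<close>, the list
      \<open>yes\<close> contains no loop, so the diagonal of the matrix is
      \<open>False\<close>.\<close>
    then show ?thesis using that irrefl Rigid.prems(2) by (auto simp: consistent_def)
  qed (use that less[of i j] less[of j i] sym in auto)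
  \<comment> \<open>Off the diagonal every position is searched; on it idempotence gives the value,
    which agrees with both projections.\<close>
  have ps: "(x, y) \<in> set ps" if "x < n" "y < n" "x \<noteq> y" for x y
    using Rigid.prems(1) that
    by (cases x y rule: linorder_cases) (auto simp: list_all_iff set_vertex_pairs)
  show ?case
    unfolding binary_rigid_def
  proof (intro allI impI, elim conjE)
    fix f
    assume f: "\<forall>x<n. \<forall>y<n. f x y < n" "\<forall>x<n. f x x = x"
      "\<forall>a<n. \<forall>b<n. \<forall>x<n. \<forall>y<n. A a x \<and> A b y \<longrightarrow> A (f a b) (f x y)"
    have "(\<forall>(x, y) \<in> set ps. f x y = x) \<or> (\<forall>(x, y) \<in> set ps. f x y = y)"
    proof (rule search_sound)
      show "search ?T ps [?M]" "\<forall>(x, y) \<in> set ps. x < n \<and> y < n"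
        using Rigid.prems(1) by (auto simp: list_all_iff)
      show "\<forall>(a, b, w) \<in> set ?M. a < n \<and> b < n \<and> w = f a b"
        using f(2) by auto
    qed (use f T in auto)
    then show "(\<forall>x<n. \<forall>y<n. f x y = x) \<or> (\<forall>x<n. \<forall>y<n. f x y = y)"
      using ps f(2) by (smt (verit) case_prodD)
  qed
qed

end

subsection \<open>The cores with three to seven vertices\<close>

definition cores3 :: core_cert where
  "cores3 =
   Split 0 1 (Split 0 2 (Split 1 2 (Rigid [(0, 1), (1, 0), (0, 2), (2, 0), (1, 2), (2, 1)]) (Endo
   [0, 2, 2])) (Endo [0, 1, 0])) (Split 0 2 (Endo [0, 0, 2]) (Endo [1, 1, 2]))"

lemma check_cores3: "check_core 3 cores3 [] []"
  unfolding cores3_def by code_simp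

definition cores4 :: core_cert where
  "cores4 =
   Split 0 1 (Split 0 2 (Split 1 2 (Split 0 3 (Split 1 3 (Split 2 3 (Rigid [(0, 1), (1, 0), (0,
   2), (2, 0), (1, 2), (2, 1), (0, 3), (3, 0), (1, 3), (2, 3), (3, 1), (3, 2)]) (Endo [0, 1, 3,
   3])) (Endo [0, 1, 2, 1])) (Endo [0, 1, 2, 0])) (Split 0 3 (Split 1 3 (Endo [0, 1, 1, 3]) (Endo
   [0, 2, 2, 3])) (Endo [0, 1, 2, 0]))) (Split 1 2 (Relabel [1, 0, 2, 3]) (Split 0 3 (Endo [0, 1,
   0, 3]) (Endo [0, 1, 1, 0])))) (Split 0 2 (Relabel [0, 2, 1, 3]) (Split 1 2 (Relabel [1, 0, 2,
   3]) (Split 0 3 (Endo [0, 0, 2, 3]) (Endo [1, 1, 2, 3]))))"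

lemma check_cores4: "check_core 4 cores4 [] []"
  unfolding cores4_def by code_simp

text \<open>The \<open>Rigid\<close> leaves are the complete graph and the cycle 0, 1, 3, 4,
  2.\<close>

definition cores5 :: core_cert where
  "cores5 =
   Split 0 1 (Split 0 2 (Split 1 2 (Split 0 3 (Split 1 3 (Split 2 3 (Split 0 4 (Split 1 4 (Split 2
   4 (Split 3 4 (Rigid [(0, 1), (1, 0), (0, 2), (2, 0), (1, 2), (2, 1), (0, 3), (3, 0), (1, 3),
   (2, 3), (3, 1), (3, 2), (0, 4), (4, 0), (1, 4), (2, 4), (3, 4), (4, 1), (4, 2), (4, 3)]) (Endo
   [0, 1, 2, 4, 4])) (Endo [0, 1, 2, 3, 2])) (Endo [0, 1, 2, 3, 1])) (Endo [0, 1, 2, 3, 0]))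
   (Split 0 4 (Split 1 4 (Split 2 4 (Endo [0, 1, 2, 2, 4]) (Endo [0, 1, 3, 3, 4])) (Endo [0, 1, 2,
   3, 1])) (Endo [0, 1, 2, 3, 0]))) (Split 2 3 (Relabel [0, 2, 1, 3, 4]) (Split 0 4 (Split 1 4
   (Endo [0, 1, 2, 1, 4]) (Endo [0, 1, 2, 2, 1])) (Endo [0, 1, 2, 3, 0])))) (Split 1 3 (Relabel
   [1, 0, 2, 3, 4]) (Split 2 3 (Relabel [0, 2, 1, 3, 4]) (Split 0 4 (Endo [0, 1, 2, 0, 4]) (Endo
   [0, 1, 2, 1, 0]))))) (Split 0 3 (Split 1 3 (Relabel [0, 1, 3, 2, 4]) (Split 2 3 (Relabel [0, 2,
   1, 3, 4]) (Split 0 4 (Split 1 4 (Endo [0, 1, 1, 3, 4]) (Endo [0, 2, 2, 3, 4])) (Endo [0, 1, 2,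
   3, 0])))) (Split 1 3 (Split 2 3 (Split 0 4 (Endo [0, 1, 2, 0, 4]) (Endo [3, 1, 2, 3, 4]))
   (Split 0 4 (Endo [0, 1, 2, 0, 4]) (Split 1 4 (Endo [0, 1, 1, 3, 4]) (Split 2 4 (Split 3 4
   (Rigid [(0, 4), (2, 3), (4, 1), (3, 0), (1, 2), (2, 0), (1, 4), (0, 2), (1, 3), (0, 1), (3, 4),
   (4, 2), (2, 4), (4, 3), (2, 1), (3, 1), (4, 0), (1, 0), (3, 2), (0, 3)]) (Endo [0, 1, 2, 0,
   4])) (Endo [0, 1, 1, 3, 4]))))) (Split 2 3 (Relabel [0, 2, 1, 3, 4]) (Split 0 4 (Endo [0, 1, 2,
   0, 4]) (Endo [0, 1, 1, 1, 0])))))) (Split 1 2 (Relabel [1, 0, 2, 3, 4]) (Split 0 3 (Relabel [0,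
   1, 3, 2, 4]) (Split 1 3 (Relabel [0, 1, 3, 2, 4]) (Split 2 3 (Split 0 4 (Relabel [0, 1, 2, 4,
   3]) (Split 1 4 (Endo [4, 1, 2, 3, 4]) (Endo [2, 3, 2, 3, 4]))) (Split 0 4 (Endo [0, 1, 0, 3,
   4]) (Endo [0, 1, 1, 1, 0]))))))) (Split 0 2 (Relabel [0, 2, 1, 3, 4]) (Split 1 2 (Relabel [1,
   0, 2, 3, 4]) (Split 0 3 (Relabel [0, 1, 3, 2, 4]) (Split 1 3 (Relabel [0, 1, 3, 2, 4]) (Split 2
   3 (Relabel [0, 2, 1, 3, 4]) (Split 0 4 (Endo [0, 0, 2, 3, 4]) (Endo [1, 1, 2, 3, 4])))))))"

lemma check_cores5: "check_core 5 cores5 [] []"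
  unfolding cores5_def by code_simp

text \<open>The \<open>Rigid\<close> leaves are the complete graph and the wheel with hub 0 and rim
  1, 2, 4, 5, 3.\<close>

definition cores6 :: core_cert where
  "cores6 =
   Split 0 1 (Split 0 2 (Split 1 2 (Split 0 3 (Split 1 3 (Split 2 3 (Split 0 4 (Split 1 4 (Split 2
   4 (Split 3 4 (Split 0 5 (Split 1 5 (Split 2 5 (Split 3 5 (Split 4 5 (Rigid [(0, 1), (1, 0), (0,
   2), (2, 0), (1, 2), (2, 1), (0, 3), (3, 0), (1, 3), (2, 3), (3, 1), (3, 2), (0, 4), (4, 0), (1,
   4), (2, 4), (3, 4), (4, 1), (4, 2), (4, 3), (0, 5), (5, 0), (1, 5), (2, 5), (3, 5), (4, 5), (5,
   1), (5, 2), (5, 3), (5, 4)]) (Endo [0, 1, 2, 3, 5, 5])) (Endo [0, 1, 2, 3, 4, 3])) (Endo [0, 1,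
   2, 3, 4, 2])) (Endo [0, 1, 2, 3, 4, 1])) (Endo [0, 1, 2, 3, 4, 0])) (Split 0 5 (Split 1 5
   (Split 2 5 (Split 3 5 (Endo [0, 1, 2, 3, 3, 5]) (Endo [0, 1, 2, 4, 4, 5])) (Endo [0, 1, 2, 3,
   4, 2])) (Endo [0, 1, 2, 3, 4, 1])) (Endo [0, 1, 2, 3, 4, 0]))) (Split 3 4 (Relabel [0, 1, 3, 2,
   4, 5]) (Split 0 5 (Split 1 5 (Split 2 5 (Endo [0, 1, 2, 3, 2, 5]) (Endo [0, 1, 2, 3, 3, 2]))
   (Endo [0, 1, 2, 3, 4, 1])) (Endo [0, 1, 2, 3, 4, 0])))) (Split 2 4 (Relabel [0, 2, 1, 3, 4, 5])
   (Split 3 4 (Relabel [0, 1, 3, 2, 4, 5]) (Split 0 5 (Split 1 5 (Endo [0, 1, 2, 3, 1, 5]) (Endo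
   [0, 1, 2, 3, 2, 1])) (Endo [0, 1, 2, 3, 4, 0]))))) (Split 1 4 (Relabel [1, 0, 2, 3, 4, 5])
   (Split 2 4 (Relabel [0, 2, 1, 3, 4, 5]) (Split 3 4 (Relabel [0, 1, 3, 2, 4, 5]) (Split 0 5
   (Endo [0, 1, 2, 3, 0, 5]) (Endo [0, 1, 2, 3, 1, 0])))))) (Split 0 4 (Split 1 4 (Split 2 4
   (Relabel [0, 1, 2, 4, 3, 5]) (Split 3 4 (Relabel [0, 1, 3, 2, 4, 5]) (Split 0 5 (Split 1 5
   (Split 2 5 (Endo [0, 1, 2, 2, 4, 5]) (Endo [0, 1, 3, 3, 4, 5])) (Endo [0, 1, 2, 3, 4, 1]))
   (Endo [0, 1, 2, 3, 4, 0])))) (Split 2 4 (Split 3 4 (Split 0 5 (Split 1 5 (Endo [0, 1, 2, 3, 1,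
   5]) (Endo [0, 4, 2, 3, 4, 5])) (Endo [0, 1, 2, 3, 4, 0])) (Split 0 5 (Split 1 5 (Endo [0, 1, 2,
   3, 1, 5]) (Split 2 5 (Endo [0, 1, 2, 2, 4, 5]) (Split 3 5 (Split 4 5 (Rigid [(0, 1), (1, 0),
   (0, 4), (0, 5), (2, 0), (0, 2), (0, 3), (1, 5), (2, 5), (3, 0), (1, 2), (1, 3), (1, 4), (3, 4),
   (4, 0), (2, 1), (2, 3), (2, 4), (4, 3), (5, 0), (3, 1), (3, 2), (3, 5), (4, 1), (4, 2), (4, 5),
   (5, 1), (5, 2), (5, 3), (5, 4)]) (Endo [0, 1, 2, 3, 1, 5])) (Endo [0, 1, 2, 2, 4, 5])))) (Endo
   [0, 1, 2, 3, 4, 0]))) (Split 3 4 (Relabel [0, 1, 3, 2, 4, 5]) (Split 0 5 (Split 1 5 (Endo [0,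
   1, 2, 3, 1, 5]) (Endo [0, 1, 2, 2, 2, 1])) (Endo [0, 1, 2, 3, 4, 0]))))) (Split 1 4 (Relabel
   [1, 0, 2, 3, 4, 5]) (Split 2 4 (Split 3 4 (Split 0 5 (Endo [0, 1, 2, 3, 0, 5]) (Endo [0, 1, 2,
   2, 1, 0])) (Split 0 5 (Endo [0, 1, 2, 3, 0, 5]) (Endo [0, 1, 2, 2, 1, 0]))) (Split 3 4 (Relabel
   [0, 1, 3, 2, 4, 5]) (Split 0 5 (Endo [0, 1, 2, 3, 0, 5]) (Endo [0, 1, 2, 2, 1, 0]))))))) (Split
   2 3 (Relabel [0, 2, 1, 3, 4, 5]) (Split 0 4 (Split 1 4 (Relabel [0, 1, 2, 4, 3, 5]) (Split 2 4
   (Relabel [0, 1, 2, 4, 3, 5]) (Split 3 4 (Split 0 5 (Split 1 5 (Relabel [0, 1, 2, 3, 5, 4])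
   (Split 2 5 (Endo [0, 5, 2, 3, 4, 5]) (Endo [0, 3, 4, 3, 4, 5]))) (Endo [0, 1, 2, 3, 4, 0]))
   (Split 0 5 (Split 1 5 (Endo [0, 1, 2, 1, 4, 5]) (Endo [0, 1, 2, 2, 2, 1])) (Endo [0, 1, 2, 3,
   4, 0]))))) (Split 1 4 (Split 2 4 (Relabel [1, 0, 2, 4, 3, 5]) (Split 3 4 (Split 0 5 (Endo [0,
   1, 2, 3, 0, 5]) (Endo [0, 1, 2, 1, 2, 0])) (Split 0 5 (Endo [0, 1, 2, 3, 0, 5]) (Endo [0, 1, 2,
   1, 2, 0])))) (Split 2 4 (Relabel [0, 2, 1, 3, 4, 5]) (Split 3 4 (Split 0 5 (Endo [0, 1, 2, 3,
   0, 5]) (Endo [0, 1, 2, 1, 2, 0])) (Split 0 5 (Endo [0, 1, 2, 3, 0, 5]) (Endo [0, 1, 2, 1, 1,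
   0])))))))) (Split 1 3 (Relabel [1, 0, 2, 3, 4, 5]) (Split 2 3 (Relabel [0, 2, 1, 3, 4, 5])
   (Split 0 4 (Relabel [0, 1, 2, 4, 3, 5]) (Split 1 4 (Relabel [0, 1, 2, 4, 3, 5]) (Split 2 4
   (Relabel [0, 1, 2, 4, 3, 5]) (Split 3 4 (Split 0 5 (Relabel [0, 1, 2, 3, 5, 4]) (Endo [0, 1, 2,
   1, 2, 0])) (Split 0 5 (Endo [0, 1, 2, 0, 4, 5]) (Endo [0, 1, 2, 1, 1, 0]))))))))) (Split 0 3
   (Split 1 3 (Relabel [0, 1, 3, 2, 4, 5]) (Split 2 3 (Relabel [0, 2, 1, 3, 4, 5]) (Split 0 4
   (Split 1 4 (Relabel [0, 1, 2, 4, 3, 5]) (Split 2 4 (Relabel [0, 1, 2, 4, 3, 5]) (Split 3 4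
   (Relabel [0, 1, 3, 2, 4, 5]) (Split 0 5 (Split 1 5 (Endo [0, 1, 1, 3, 4, 5]) (Endo [0, 2, 2, 3,
   4, 5])) (Endo [0, 1, 2, 3, 4, 0]))))) (Split 1 4 (Split 2 4 (Split 3 4 (Split 0 5 (Endo [0, 1,
   2, 3, 0, 5]) (Endo [4, 1, 2, 3, 4, 5])) (Split 0 5 (Endo [0, 1, 2, 3, 0, 5]) (Split 1 5 (Endo
   [0, 1, 1, 3, 4, 5]) (Endo [0, 2, 2, 3, 4, 5])))) (Split 3 4 (Relabel [0, 1, 3, 2, 4, 5]) (Split
   0 5 (Endo [0, 1, 2, 3, 0, 5]) (Split 1 5 (Endo [0, 1, 1, 3, 4, 5]) (Split 2 5 (Endo [0, 1, 2,
   2, 4, 5]) (Endo [0, 1, 1, 3, 4, 5])))))) (Split 2 4 (Relabel [0, 2, 1, 3, 4, 5]) (Split 3 4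
   (Relabel [0, 1, 3, 2, 4, 5]) (Split 0 5 (Endo [0, 1, 2, 3, 0, 5]) (Endo [0, 1, 1, 1, 1,
   0])))))))) (Split 1 3 (Split 2 3 (Split 0 4 (Relabel [0, 1, 2, 4, 3, 5]) (Split 1 4 (Relabel
   [1, 0, 3, 2, 4, 5]) (Split 2 4 (Relabel [0, 2, 1, 3, 4, 5]) (Split 3 4 (Relabel [3, 1, 2, 0, 4,
   5]) (Split 0 5 (Endo [0, 1, 2, 0, 4, 5]) (Endo [3, 1, 2, 3, 4, 5])))))) (Split 0 4 (Relabel [0,
   1, 2, 4, 3, 5]) (Split 1 4 (Relabel [1, 0, 3, 2, 4, 5]) (Split 2 4 (Split 3 4 (Split 0 5
   (Relabel [0, 1, 2, 3, 5, 4]) (Split 1 5 (Relabel [0, 1, 2, 3, 5, 4]) (Split 2 5 (Relabel [0, 2,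
   1, 4, 3, 5]) (Split 3 5 (Relabel [1, 0, 3, 2, 4, 5]) (Endo [0, 1, 2, 3, 4, 2]))))) (Split 0 5
   (Endo [0, 1, 2, 0, 4, 5]) (Split 1 5 (Relabel [0, 1, 2, 3, 5, 4]) (Split 2 5 (Relabel [0, 2, 1,
   4, 3, 5]) (Endo [0, 1, 1, 0, 0, 1]))))) (Split 3 4 (Relabel [1, 0, 3, 2, 4, 5]) (Split 0 5
   (Endo [0, 1, 2, 0, 4, 5]) (Split 1 5 (Endo [0, 1, 1, 3, 4, 5]) (Split 2 5 (Endo [0, 1, 2, 3, 2,
   5]) (Endo [0, 1, 1, 3, 4, 5]))))))))) (Split 2 3 (Relabel [0, 2, 1, 3, 4, 5]) (Split 0 4
   (Relabel [0, 1, 2, 4, 3, 5]) (Split 1 4 (Relabel [0, 1, 2, 4, 3, 5]) (Split 2 4 (Relabel [0, 1,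
   2, 4, 3, 5]) (Split 3 4 (Split 0 5 (Relabel [0, 1, 2, 3, 5, 4]) (Split 1 5 (Endo [0, 1, 1, 3,
   4, 5]) (Endo [0, 2, 2, 3, 4, 5]))) (Split 0 5 (Endo [0, 1, 2, 0, 4, 5]) (Endo [0, 1, 1, 1, 1,
   0])))))))))) (Split 1 2 (Relabel [1, 0, 2, 3, 4, 5]) (Split 0 3 (Relabel [0, 1, 3, 2, 4, 5])
   (Split 1 3 (Relabel [0, 1, 3, 2, 4, 5]) (Split 2 3 (Split 0 4 (Relabel [0, 1, 2, 4, 3, 5])
   (Split 1 4 (Relabel [0, 1, 2, 4, 3, 5]) (Split 2 4 (Relabel [2, 3, 0, 1, 4, 5]) (Split 3 4
   (Relabel [0, 1, 3, 2, 4, 5]) (Split 0 5 (Endo [0, 1, 2, 3, 0, 5]) (Split 1 5 (Endo [5, 1, 2, 3,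
   4, 5]) (Endo [2, 3, 2, 3, 4, 5]))))))) (Split 0 4 (Relabel [0, 1, 2, 4, 3, 5]) (Split 1 4
   (Relabel [0, 1, 2, 4, 3, 5]) (Split 2 4 (Relabel [0, 1, 2, 4, 3, 5]) (Split 3 4 (Relabel [0, 1,
   3, 2, 4, 5]) (Split 0 5 (Endo [0, 1, 0, 3, 4, 5]) (Endo [0, 1, 1, 1, 1, 0]))))))))))) (Split 0
   2 (Relabel [0, 2, 1, 3, 4, 5]) (Split 1 2 (Relabel [1, 0, 2, 3, 4, 5]) (Split 0 3 (Relabel [0,
   1, 3, 2, 4, 5]) (Split 1 3 (Relabel [0, 1, 3, 2, 4, 5]) (Split 2 3 (Relabel [0, 2, 1, 3, 4, 5])
   (Split 0 4 (Relabel [0, 1, 2, 4, 3, 5]) (Split 1 4 (Relabel [0, 1, 2, 4, 3, 5]) (Split 2 4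
   (Relabel [0, 1, 2, 4, 3, 5]) (Split 3 4 (Relabel [0, 1, 3, 2, 4, 5]) (Split 0 5 (Endo [0, 0, 2,
   3, 4, 5]) (Endo [1, 1, 2, 3, 4, 5])))))))))))"

lemma check_cores6: "check_core 6 cores6 [] []"
  unfolding cores6_def by code_simp

text \<open>There are ten \<open>Rigid\<close> leaves, among them the complete graph, the join of an
  edge with a 5-cycle, and the cycle 0, 1, 3, 5, 6, 4, 2.\<close>

definition cores7 :: core_cert where
  "cores7 =
   Split 0 1 (Split 0 2 (Split 1 2 (Split 0 3 (Split 1 3 (Split 2 3 (Split 0 4 (Split 1 4 (Split 2
   4 (Split 3 4 (Split 0 5 (Split 1 5 (Split 2 5 (Split 3 5 (Split 4 5 (Split 0 6 (Split 1 6
   (Split 2 6 (Split 3 6 (Split 4 6 (Split 5 6 (Rigid [(0, 1), (1, 0), (0, 2), (2, 0), (1, 2), (2,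
   1), (0, 3), (3, 0), (1, 3), (2, 3), (3, 1), (3, 2), (0, 4), (4, 0), (1, 4), (2, 4), (3, 4), (4,
   1), (4, 2), (4, 3), (0, 5), (5, 0), (1, 5), (2, 5), (3, 5), (4, 5), (5, 1), (5, 2), (5, 3), (5,
   4), (0, 6), (6, 0), (1, 6), (2, 6), (3, 6), (4, 6), (5, 6), (6, 1), (6, 2), (6, 3), (6, 4), (6,
   5)]) (Endo [0, 1, 2, 3, 4, 6, 6])) (Endo [0, 1, 2, 3, 4, 5, 4])) (Endo [0, 1, 2, 3, 4, 5, 3]))
   (Endo [0, 1, 2, 3, 4, 5, 2])) (Endo [0, 1, 2, 3, 4, 5, 1])) (Endo [0, 1, 2, 3, 4, 5, 0]))
   (Split 0 6 (Split 1 6 (Split 2 6 (Split 3 6 (Split 4 6 (Endo [0, 1, 2, 3, 4, 4, 6]) (Endo [0,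
   1, 2, 3, 5, 5, 6])) (Endo [0, 1, 2, 3, 4, 5, 3])) (Endo [0, 1, 2, 3, 4, 5, 2])) (Endo [0, 1, 2,
   3, 4, 5, 1])) (Endo [0, 1, 2, 3, 4, 5, 0]))) (Split 4 5 (Relabel [0, 1, 2, 4, 3, 5, 6]) (Split
   0 6 (Split 1 6 (Split 2 6 (Split 3 6 (Endo [0, 1, 2, 3, 4, 3, 6]) (Endo [0, 1, 2, 3, 4, 4, 3]))
   (Endo [0, 1, 2, 3, 4, 5, 2])) (Endo [0, 1, 2, 3, 4, 5, 1])) (Endo [0, 1, 2, 3, 4, 5, 0]))))
   (Split 3 5 (Relabel [0, 1, 3, 2, 4, 5, 6]) (Split 4 5 (Relabel [0, 1, 2, 4, 3, 5, 6]) (Split 0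
   6 (Split 1 6 (Split 2 6 (Endo [0, 1, 2, 3, 4, 2, 6]) (Endo [0, 1, 2, 3, 4, 3, 2])) (Endo [0, 1,
   2, 3, 4, 5, 1])) (Endo [0, 1, 2, 3, 4, 5, 0]))))) (Split 2 5 (Relabel [0, 2, 1, 3, 4, 5, 6])
   (Split 3 5 (Relabel [0, 1, 3, 2, 4, 5, 6]) (Split 4 5 (Relabel [0, 1, 2, 4, 3, 5, 6]) (Split 0
   6 (Split 1 6 (Endo [0, 1, 2, 3, 4, 1, 6]) (Endo [0, 1, 2, 3, 4, 2, 1])) (Endo [0, 1, 2, 3, 4,
   5, 0])))))) (Split 1 5 (Relabel [1, 0, 2, 3, 4, 5, 6]) (Split 2 5 (Relabel [0, 2, 1, 3, 4, 5,
   6]) (Split 3 5 (Relabel [0, 1, 3, 2, 4, 5, 6]) (Split 4 5 (Relabel [0, 1, 2, 4, 3, 5, 6])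
   (Split 0 6 (Endo [0, 1, 2, 3, 4, 0, 6]) (Endo [0, 1, 2, 3, 4, 1, 0]))))))) (Split 0 5 (Split 1
   5 (Split 2 5 (Split 3 5 (Relabel [0, 1, 2, 3, 5, 4, 6]) (Split 4 5 (Relabel [0, 1, 2, 4, 3, 5,
   6]) (Split 0 6 (Split 1 6 (Split 2 6 (Split 3 6 (Endo [0, 1, 2, 3, 3, 5, 6]) (Endo [0, 1, 2, 4,
   4, 5, 6])) (Endo [0, 1, 2, 3, 4, 5, 2])) (Endo [0, 1, 2, 3, 4, 5, 1])) (Endo [0, 1, 2, 3, 4, 5,
   0])))) (Split 3 5 (Split 4 5 (Split 0 6 (Split 1 6 (Split 2 6 (Endo [0, 1, 2, 3, 4, 2, 6])
   (Endo [0, 1, 5, 3, 4, 5, 6])) (Endo [0, 1, 2, 3, 4, 5, 1])) (Endo [0, 1, 2, 3, 4, 5, 0]))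
   (Split 0 6 (Split 1 6 (Split 2 6 (Endo [0, 1, 2, 3, 4, 2, 6]) (Split 3 6 (Endo [0, 1, 2, 3, 3,
   5, 6]) (Split 4 6 (Split 5 6 (Rigid [(0, 1), (1, 0), (0, 2), (2, 0), (0, 5), (0, 6), (1, 2),
   (1, 5), (1, 6), (2, 1), (3, 0), (0, 3), (0, 4), (1, 3), (1, 4), (2, 6), (3, 1), (3, 6), (4, 0),
   (2, 3), (2, 4), (2, 5), (4, 1), (4, 5), (5, 0), (3, 2), (3, 4), (3, 5), (5, 1), (5, 4), (6, 0),
   (4, 2), (4, 3), (4, 6), (5, 2), (5, 3), (5, 6), (6, 1), (6, 2), (6, 3), (6, 4), (6, 5)]) (Endo
   [0, 1, 2, 3, 4, 2, 6])) (Endo [0, 1, 2, 3, 3, 5, 6])))) (Endo [0, 1, 2, 3, 4, 5, 1])) (Endo [0,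
   1, 2, 3, 4, 5, 0]))) (Split 4 5 (Relabel [0, 1, 2, 4, 3, 5, 6]) (Split 0 6 (Split 1 6 (Split 2
   6 (Endo [0, 1, 2, 3, 4, 2, 6]) (Endo [0, 1, 2, 3, 3, 3, 2])) (Endo [0, 1, 2, 3, 4, 5, 1]))
   (Endo [0, 1, 2, 3, 4, 5, 0]))))) (Split 2 5 (Relabel [0, 2, 1, 3, 4, 5, 6]) (Split 3 5 (Split 4
   5 (Split 0 6 (Split 1 6 (Endo [0, 1, 2, 3, 4, 1, 6]) (Endo [0, 1, 2, 3, 3, 2, 1])) (Endo [0, 1,
   2, 3, 4, 5, 0])) (Split 0 6 (Split 1 6 (Endo [0, 1, 2, 3, 4, 1, 6]) (Endo [0, 1, 2, 3, 3, 2,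
   1])) (Endo [0, 1, 2, 3, 4, 5, 0]))) (Split 4 5 (Relabel [0, 1, 2, 4, 3, 5, 6]) (Split 0 6
   (Split 1 6 (Endo [0, 1, 2, 3, 4, 1, 6]) (Endo [0, 1, 2, 3, 3, 2, 1])) (Endo [0, 1, 2, 3, 4, 5,
   0])))))) (Split 1 5 (Relabel [1, 0, 2, 3, 4, 5, 6]) (Split 2 5 (Relabel [0, 2, 1, 3, 4, 5, 6])
   (Split 3 5 (Split 4 5 (Split 0 6 (Endo [0, 1, 2, 3, 4, 0, 6]) (Endo [0, 1, 2, 3, 3, 1, 0]))
   (Split 0 6 (Endo [0, 1, 2, 3, 4, 0, 6]) (Endo [0, 1, 2, 3, 3, 1, 0]))) (Split 4 5 (Relabel [0,
   1, 2, 4, 3, 5, 6]) (Split 0 6 (Endo [0, 1, 2, 3, 4, 0, 6]) (Endo [0, 1, 2, 3, 3, 1, 0]))))))))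
   (Split 3 4 (Relabel [0, 1, 3, 2, 4, 5, 6]) (Split 0 5 (Split 1 5 (Split 2 5 (Relabel [0, 1, 2,
   3, 5, 4, 6]) (Split 3 5 (Relabel [0, 1, 2, 3, 5, 4, 6]) (Split 4 5 (Split 0 6 (Split 1 6 (Split
   2 6 (Relabel [0, 1, 2, 3, 4, 6, 5]) (Split 3 6 (Endo [0, 1, 6, 3, 4, 5, 6]) (Endo [0, 1, 4, 5,
   4, 5, 6]))) (Endo [0, 1, 2, 3, 4, 5, 1])) (Endo [0, 1, 2, 3, 4, 5, 0])) (Split 0 6 (Split 1 6
   (Split 2 6 (Endo [0, 1, 2, 3, 2, 5, 6]) (Endo [0, 1, 2, 3, 3, 3, 2])) (Endo [0, 1, 2, 3, 4, 5,
   1])) (Endo [0, 1, 2, 3, 4, 5, 0]))))) (Split 2 5 (Split 3 5 (Relabel [0, 2, 1, 3, 5, 4, 6])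
   (Split 4 5 (Split 0 6 (Split 1 6 (Endo [0, 1, 2, 3, 4, 1, 6]) (Endo [0, 1, 2, 3, 2, 3, 1]))
   (Endo [0, 1, 2, 3, 4, 5, 0])) (Split 0 6 (Split 1 6 (Endo [0, 1, 2, 3, 4, 1, 6]) (Endo [0, 1,
   2, 3, 2, 3, 1])) (Endo [0, 1, 2, 3, 4, 5, 0])))) (Split 3 5 (Relabel [0, 1, 3, 2, 4, 5, 6])
   (Split 4 5 (Split 0 6 (Split 1 6 (Endo [0, 1, 2, 3, 4, 1, 6]) (Endo [0, 1, 2, 3, 2, 3, 1]))
   (Endo [0, 1, 2, 3, 4, 5, 0])) (Split 0 6 (Split 1 6 (Endo [0, 1, 2, 3, 4, 1, 6]) (Endo [0, 1,
   2, 3, 2, 2, 1])) (Endo [0, 1, 2, 3, 4, 5, 0])))))) (Split 1 5 (Relabel [1, 0, 2, 3, 4, 5, 6])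
   (Split 2 5 (Split 3 5 (Split 4 5 (Split 0 6 (Endo [0, 1, 2, 3, 4, 0, 6]) (Endo [0, 1, 2, 3, 2,
   1, 0])) (Split 0 6 (Endo [0, 1, 2, 3, 4, 0, 6]) (Endo [0, 1, 2, 3, 2, 1, 0]))) (Split 4 5
   (Split 0 6 (Endo [0, 1, 2, 3, 4, 0, 6]) (Endo [0, 1, 2, 3, 2, 1, 0])) (Split 0 6 (Endo [0, 1,
   2, 3, 4, 0, 6]) (Endo [0, 1, 2, 3, 2, 1, 0])))) (Split 3 5 (Relabel [0, 1, 3, 2, 4, 5, 6])
   (Split 4 5 (Split 0 6 (Endo [0, 1, 2, 3, 4, 0, 6]) (Endo [0, 1, 2, 3, 2, 1, 0])) (Split 0 6
   (Endo [0, 1, 2, 3, 4, 0, 6]) (Endo [0, 1, 2, 3, 2, 1, 0]))))))))) (Split 2 4 (Relabel [0, 2, 1,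
   3, 4, 5, 6]) (Split 3 4 (Relabel [0, 1, 3, 2, 4, 5, 6]) (Split 0 5 (Split 1 5 (Relabel [0, 1,
   2, 3, 5, 4, 6]) (Split 2 5 (Relabel [0, 1, 2, 3, 5, 4, 6]) (Split 3 5 (Relabel [0, 1, 2, 3, 5,
   4, 6]) (Split 4 5 (Split 0 6 (Split 1 6 (Relabel [0, 1, 2, 3, 4, 6, 5]) (Endo [0, 1, 2, 3, 2,
   3, 1])) (Endo [0, 1, 2, 3, 4, 5, 0])) (Split 0 6 (Split 1 6 (Endo [0, 1, 2, 3, 1, 5, 6]) (Endo
   [0, 1, 2, 3, 2, 2, 1])) (Endo [0, 1, 2, 3, 4, 5, 0])))))) (Split 1 5 (Split 2 5 (Relabel [1, 0,
   2, 3, 5, 4, 6]) (Split 3 5 (Relabel [0, 1, 3, 2, 4, 5, 6]) (Split 4 5 (Split 0 6 (Endo [0, 1,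
   2, 3, 4, 0, 6]) (Endo [0, 1, 2, 3, 1, 2, 0])) (Split 0 6 (Endo [0, 1, 2, 3, 4, 0, 6]) (Endo [0,
   1, 2, 3, 1, 2, 0]))))) (Split 2 5 (Relabel [0, 2, 1, 3, 4, 5, 6]) (Split 3 5 (Relabel [0, 1, 3,
   2, 4, 5, 6]) (Split 4 5 (Split 0 6 (Endo [0, 1, 2, 3, 4, 0, 6]) (Endo [0, 1, 2, 3, 1, 2, 0]))
   (Split 0 6 (Endo [0, 1, 2, 3, 4, 0, 6]) (Endo [0, 1, 2, 3, 1, 1, 0])))))))))) (Split 1 4
   (Relabel [1, 0, 2, 3, 4, 5, 6]) (Split 2 4 (Relabel [0, 2, 1, 3, 4, 5, 6]) (Split 3 4 (Relabel
   [0, 1, 3, 2, 4, 5, 6]) (Split 0 5 (Relabel [0, 1, 2, 3, 5, 4, 6]) (Split 1 5 (Relabel [0, 1, 2,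
   3, 5, 4, 6]) (Split 2 5 (Relabel [0, 1, 2, 3, 5, 4, 6]) (Split 3 5 (Relabel [0, 1, 2, 3, 5, 4,
   6]) (Split 4 5 (Split 0 6 (Relabel [0, 1, 2, 3, 4, 6, 5]) (Endo [0, 1, 2, 3, 1, 2, 0])) (Split
   0 6 (Endo [0, 1, 2, 3, 0, 5, 6]) (Endo [0, 1, 2, 3, 1, 1, 0]))))))))))) (Split 0 4 (Split 1 4
   (Split 2 4 (Relabel [0, 1, 2, 4, 3, 5, 6]) (Split 3 4 (Relabel [0, 1, 3, 2, 4, 5, 6]) (Split 0
   5 (Split 1 5 (Split 2 5 (Relabel [0, 1, 2, 3, 5, 4, 6]) (Split 3 5 (Relabel [0, 1, 2, 3, 5, 4,
   6]) (Split 4 5 (Relabel [0, 1, 2, 4, 3, 5, 6]) (Split 0 6 (Split 1 6 (Split 2 6 (Endo [0, 1, 2,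
   2, 4, 5, 6]) (Endo [0, 1, 3, 3, 4, 5, 6])) (Endo [0, 1, 2, 3, 4, 5, 1])) (Endo [0, 1, 2, 3, 4,
   5, 0]))))) (Split 2 5 (Split 3 5 (Split 4 5 (Split 0 6 (Split 1 6 (Endo [0, 1, 2, 3, 4, 1, 6])
   (Endo [0, 5, 2, 3, 4, 5, 6])) (Endo [0, 1, 2, 3, 4, 5, 0])) (Split 0 6 (Split 1 6 (Endo [0, 1,
   2, 3, 4, 1, 6]) (Split 2 6 (Endo [0, 1, 2, 2, 4, 5, 6]) (Endo [0, 1, 3, 3, 4, 5, 6]))) (Endo
   [0, 1, 2, 3, 4, 5, 0]))) (Split 4 5 (Relabel [0, 1, 2, 4, 3, 5, 6]) (Split 0 6 (Split 1 6 (Endo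
   [0, 1, 2, 3, 4, 1, 6]) (Split 2 6 (Endo [0, 1, 2, 2, 4, 5, 6]) (Split 3 6 (Endo [0, 1, 2, 3, 3,
   5, 6]) (Endo [0, 1, 2, 2, 4, 5, 6])))) (Endo [0, 1, 2, 3, 4, 5, 0])))) (Split 3 5 (Relabel [0,
   1, 3, 2, 4, 5, 6]) (Split 4 5 (Relabel [0, 1, 2, 4, 3, 5, 6]) (Split 0 6 (Split 1 6 (Endo [0,
   1, 2, 3, 4, 1, 6]) (Endo [0, 1, 2, 2, 2, 2, 1])) (Endo [0, 1, 2, 3, 4, 5, 0])))))) (Split 1 5
   (Relabel [1, 0, 2, 3, 4, 5, 6]) (Split 2 5 (Split 3 5 (Split 4 5 (Split 0 6 (Endo [0, 1, 2, 3,
   4, 0, 6]) (Endo [0, 1, 2, 2, 2, 1, 0])) (Split 0 6 (Endo [0, 1, 2, 3, 4, 0, 6]) (Endo [0, 1, 2,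
   2, 2, 1, 0]))) (Split 4 5 (Relabel [0, 1, 2, 4, 3, 5, 6]) (Split 0 6 (Endo [0, 1, 2, 3, 4, 0,
   6]) (Endo [0, 1, 2, 2, 2, 1, 0])))) (Split 3 5 (Relabel [0, 1, 3, 2, 4, 5, 6]) (Split 4 5
   (Relabel [0, 1, 2, 4, 3, 5, 6]) (Split 0 6 (Endo [0, 1, 2, 3, 4, 0, 6]) (Endo [0, 1, 2, 2, 2,
   1, 0]))))))))) (Split 2 4 (Split 3 4 (Split 0 5 (Split 1 5 (Relabel [0, 1, 2, 3, 5, 4, 6])
   (Split 2 5 (Relabel [0, 2, 1, 4, 3, 5, 6]) (Split 3 5 (Relabel [0, 1, 3, 2, 4, 5, 6]) (Split 4
   5 (Relabel [0, 4, 2, 3, 1, 5, 6]) (Split 0 6 (Split 1 6 (Endo [0, 1, 2, 3, 1, 5, 6]) (Endo [0,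
   4, 2, 3, 4, 5, 6])) (Endo [0, 1, 2, 3, 4, 5, 0])))))) (Split 1 5 (Split 2 5 (Split 3 5 (Split 4
   5 (Split 0 6 (Endo [0, 1, 2, 3, 4, 0, 6]) (Endo [5, 1, 2, 3, 4, 5, 6])) (Split 0 6 (Endo [0, 1,
   2, 3, 4, 0, 6]) (Split 1 6 (Endo [0, 1, 2, 3, 1, 5, 6]) (Split 2 6 (Endo [0, 1, 2, 2, 4, 5, 6])
   (Endo [0, 1, 3, 3, 4, 5, 6]))))) (Split 4 5 (Relabel [0, 2, 1, 4, 3, 5, 6]) (Split 0 6 (Endo
   [0, 1, 2, 3, 4, 0, 6]) (Split 1 6 (Endo [0, 1, 2, 3, 1, 5, 6]) (Split 2 6 (Endo [0, 1, 2, 2, 4,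
   5, 6]) (Split 3 6 (Split 4 6 (Split 5 6 (Rigid [(6, 1), (4, 0), (0, 1), (4, 5), (3, 2), (0, 4),
   (1, 6), (0, 5), (0, 6), (1, 4), (5, 0), (2, 3), (5, 4), (1, 0), (6, 0), (4, 1), (1, 2), (2, 0),
   (0, 2), (0, 3), (1, 3), (2, 1), (2, 4), (2, 6), (3, 0), (3, 1), (3, 4), (3, 5), (4, 2), (4, 3),
   (5, 3), (6, 2), (1, 5), (5, 1), (2, 5), (5, 2), (3, 6), (6, 3), (4, 6), (5, 6), (6, 4), (6,
   5)]) (Endo [0, 1, 2, 3, 4, 0, 6])) (Endo [0, 1, 2, 3, 1, 5, 6])) (Endo [0, 1, 2, 2, 4, 5,
   6]))))))) (Split 3 5 (Relabel [0, 1, 3, 2, 4, 5, 6]) (Split 4 5 (Split 0 6 (Endo [0, 1, 2, 3,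
   4, 0, 6]) (Endo [0, 1, 2, 2, 1, 2, 0])) (Split 0 6 (Endo [0, 1, 2, 3, 4, 0, 6]) (Endo [0, 1, 2,
   2, 1, 2, 0]))))) (Split 2 5 (Relabel [0, 2, 1, 4, 3, 5, 6]) (Split 3 5 (Relabel [0, 1, 3, 2, 4,
   5, 6]) (Split 4 5 (Relabel [0, 4, 2, 3, 1, 5, 6]) (Split 0 6 (Endo [0, 1, 2, 3, 4, 0, 6]) (Endo
   [0, 1, 2, 2, 1, 1, 0]))))))) (Split 0 5 (Split 1 5 (Relabel [0, 1, 2, 3, 5, 4, 6]) (Split 2 5
   (Relabel [0, 2, 1, 4, 3, 5, 6]) (Split 3 5 (Split 4 5 (Split 0 6 (Split 1 6 (Relabel [0, 1, 2,
   3, 4, 6, 5]) (Split 2 6 (Relabel [0, 1, 2, 3, 4, 6, 5]) (Split 3 6 (Relabel [0, 1, 3, 2, 5, 4,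
   6]) (Split 4 6 (Relabel [0, 2, 1, 4, 3, 5, 6]) (Endo [0, 1, 2, 3, 4, 5, 3]))))) (Endo [0, 1, 2,
   3, 4, 5, 0])) (Split 0 6 (Split 1 6 (Endo [0, 1, 2, 3, 1, 5, 6]) (Split 2 6 (Relabel [0, 1, 2,
   3, 4, 6, 5]) (Split 3 6 (Relabel [0, 1, 3, 2, 5, 4, 6]) (Endo [0, 1, 2, 2, 1, 1, 2])))) (Endo
   [0, 1, 2, 3, 4, 5, 0]))) (Split 4 5 (Relabel [0, 2, 1, 4, 3, 5, 6]) (Split 0 6 (Split 1 6 (Endo
   [0, 1, 2, 3, 1, 5, 6]) (Split 2 6 (Endo [0, 1, 2, 2, 4, 5, 6]) (Split 3 6 (Endo [0, 1, 2, 3, 4,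
   3, 6]) (Endo [0, 1, 2, 2, 4, 5, 6])))) (Endo [0, 1, 2, 3, 4, 5, 0])))))) (Split 1 5 (Split 2 5
   (Split 3 5 (Relabel [1, 0, 2, 3, 5, 4, 6]) (Split 4 5 (Relabel [0, 2, 1, 4, 3, 5, 6]) (Split 0
   6 (Endo [0, 1, 2, 3, 4, 0, 6]) (Split 1 6 (Endo [0, 1, 2, 3, 1, 5, 6]) (Split 2 6 (Endo [0, 1,
   2, 2, 4, 5, 6]) (Split 3 6 (Split 4 6 (Split 5 6 (Rigid [(0, 1), (1, 0), (4, 5), (5, 4), (0,
   2), (2, 0), (1, 2), (2, 1), (3, 4), (3, 5), (4, 3), (5, 3), (0, 6), (1, 3), (3, 0), (6, 1), (1,
   4), (2, 6), (0, 3), (0, 4), (1, 6), (3, 2), (0, 5), (1, 5), (4, 0), (2, 3), (2, 4), (4, 2), (2,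
   5), (5, 0), (5, 2), (6, 0), (3, 1), (4, 1), (5, 1), (6, 2), (3, 6), (6, 3), (4, 6), (5, 6), (6,
   4), (6, 5)]) (Endo [0, 1, 2, 3, 4, 0, 6])) (Endo [0, 1, 2, 3, 1, 5, 6])) (Endo [0, 1, 2, 2, 4,
   5, 6]))))))) (Split 3 5 (Split 4 5 (Split 0 6 (Endo [0, 1, 2, 3, 4, 0, 6]) (Split 1 6 (Endo [0,
   1, 2, 3, 1, 5, 6]) (Split 2 6 (Split 3 6 (Split 4 6 (Split 5 6 (Rigid [(1, 6), (0, 4), (0, 5),
   (2, 6), (1, 5), (0, 3), (0, 6), (2, 5), (3, 1), (1, 0), (0, 1), (0, 2), (1, 2), (1, 3), (2, 0),
   (3, 4), (3, 6), (1, 4), (4, 2), (2, 1), (2, 4), (4, 3), (4, 5), (2, 3), (5, 2), (3, 0), (5, 3),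
   (3, 5), (5, 4), (3, 2), (6, 0), (4, 1), (5, 1), (6, 1), (4, 0), (5, 0), (6, 2), (4, 6), (5, 6),
   (6, 3), (6, 4), (6, 5)]) (Endo [0, 1, 2, 3, 4, 0, 6])) (Endo [0, 1, 2, 3, 1, 5, 6])) (Split 4 6
   (Split 5 6 (Rigid [(0, 6), (1, 5), (0, 1), (1, 0), (2, 4), (0, 2), (2, 0), (0, 3), (2, 5), (2,
   6), (0, 4), (0, 5), (3, 1), (1, 2), (1, 3), (3, 4), (1, 6), (3, 6), (1, 4), (4, 2), (2, 1), (4,
   5), (2, 3), (5, 2), (3, 0), (5, 4), (3, 2), (3, 5), (6, 0), (4, 1), (4, 3), (5, 1), (5, 3), (6,
   1), (4, 0), (5, 0), (6, 2), (4, 6), (5, 6), (6, 3), (6, 4), (6, 5)]) (Endo [0, 1, 2, 3, 4, 0,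
   6])) (Endo [0, 1, 2, 3, 1, 5, 6]))) (Split 3 6 (Relabel [1, 0, 3, 2, 5, 4, 6]) (Endo [0, 1, 2,
   2, 1, 0, 2]))))) (Split 0 6 (Endo [0, 1, 2, 3, 4, 0, 6]) (Split 1 6 (Endo [0, 1, 2, 3, 1, 5,
   6]) (Split 2 6 (Split 3 6 (Split 4 6 (Relabel [0, 2, 1, 4, 3, 6, 5]) (Endo [0, 1, 2, 3, 1, 5,
   6])) (Split 4 6 (Split 5 6 (Rigid [(0, 1), (1, 0), (0, 2), (2, 0), (1, 3), (2, 4), (1, 6), (0,
   4), (2, 5), (0, 3), (3, 1), (1, 2), (0, 6), (1, 5), (2, 6), (0, 5), (3, 6), (1, 4), (4, 2), (2,
   1), (4, 5), (2, 3), (5, 2), (3, 0), (3, 4), (5, 4), (3, 2), (6, 0), (4, 1), (4, 3), (5, 1), (3,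
   5), (5, 3), (6, 1), (4, 0), (5, 0), (6, 2), (4, 6), (5, 6), (6, 3), (6, 4), (6, 5)]) (Endo [0,
   1, 2, 3, 4, 0, 6])) (Endo [0, 1, 2, 3, 1, 5, 6]))) (Split 3 6 (Relabel [1, 0, 3, 2, 5, 4, 6])
   (Endo [0, 1, 2, 2, 1, 0, 2])))))) (Split 4 5 (Split 0 6 (Endo [0, 1, 2, 3, 4, 0, 6]) (Endo [0,
   1, 2, 2, 1, 2, 0])) (Split 0 6 (Endo [0, 1, 2, 3, 4, 0, 6]) (Endo [0, 1, 2, 2, 1, 2, 0])))))
   (Split 2 5 (Relabel [0, 2, 1, 4, 3, 5, 6]) (Split 3 5 (Split 4 5 (Split 0 6 (Endo [0, 1, 2, 3,
   4, 0, 6]) (Split 1 6 (Relabel [0, 1, 2, 3, 4, 6, 5]) (Split 2 6 (Relabel [0, 1, 2, 3, 4, 6, 5])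
   (Split 3 6 (Split 4 6 (Split 5 6 (Rigid [(1, 4), (3, 5), (0, 3), (0, 6), (1, 5), (0, 4), (1,
   0), (0, 1), (1, 3), (1, 6), (0, 5), (2, 0), (0, 2), (2, 5), (2, 6), (3, 4), (1, 2), (3, 6), (4,
   3), (2, 1), (4, 5), (2, 3), (2, 4), (4, 6), (3, 0), (5, 3), (3, 1), (4, 0), (4, 1), (6, 0), (3,
   2), (4, 2), (5, 1), (5, 2), (5, 4), (6, 1), (5, 0), (6, 2), (6, 3), (5, 6), (6, 4), (6, 5)])
   (Endo [0, 1, 2, 3, 4, 0, 6])) (Endo [0, 1, 2, 2, 1, 0, 1])) (Endo [0, 1, 2, 2, 1, 0, 2])))))
   (Split 0 6 (Endo [0, 1, 2, 3, 4, 0, 6]) (Endo [0, 1, 2, 2, 1, 1, 0]))) (Split 4 5 (Relabel [0,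
   2, 1, 4, 3, 5, 6]) (Split 0 6 (Endo [0, 1, 2, 3, 4, 0, 6]) (Endo [0, 1, 2, 2, 1, 1, 0]))))))))
   (Split 3 4 (Relabel [0, 1, 3, 2, 4, 5, 6]) (Split 0 5 (Split 1 5 (Relabel [0, 1, 2, 3, 5, 4,
   6]) (Split 2 5 (Relabel [0, 1, 2, 3, 5, 4, 6]) (Split 3 5 (Relabel [0, 1, 2, 3, 5, 4, 6])
   (Split 4 5 (Split 0 6 (Split 1 6 (Relabel [0, 1, 2, 3, 4, 6, 5]) (Split 2 6 (Endo [0, 1, 2, 2,
   4, 5, 6]) (Endo [0, 1, 3, 3, 4, 5, 6]))) (Endo [0, 1, 2, 3, 4, 5, 0])) (Split 0 6 (Split 1 6
   (Endo [0, 1, 2, 3, 1, 5, 6]) (Endo [0, 1, 2, 2, 2, 2, 1])) (Endo [0, 1, 2, 3, 4, 5, 0]))))))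
   (Split 1 5 (Split 2 5 (Relabel [1, 0, 2, 3, 5, 4, 6]) (Split 3 5 (Relabel [0, 1, 3, 2, 4, 5,
   6]) (Split 4 5 (Split 0 6 (Endo [0, 1, 2, 3, 4, 0, 6]) (Endo [0, 1, 2, 2, 1, 2, 0])) (Split 0 6
   (Endo [0, 1, 2, 3, 4, 0, 6]) (Endo [0, 1, 2, 2, 1, 2, 0]))))) (Split 2 5 (Split 3 5 (Split 4 5
   (Split 0 6 (Endo [0, 1, 2, 3, 4, 0, 6]) (Endo [0, 1, 2, 2, 2, 1, 0])) (Split 0 6 (Endo [0, 1,
   2, 3, 4, 0, 6]) (Endo [0, 1, 2, 2, 1, 1, 0]))) (Split 4 5 (Split 0 6 (Endo [0, 1, 2, 3, 4, 0,
   6]) (Endo [0, 1, 2, 2, 2, 1, 0])) (Split 0 6 (Endo [0, 1, 2, 3, 4, 0, 6]) (Endo [0, 1, 2, 2, 1,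
   1, 0])))) (Split 3 5 (Relabel [0, 1, 3, 2, 4, 5, 6]) (Split 4 5 (Split 0 6 (Endo [0, 1, 2, 3,
   4, 0, 6]) (Endo [0, 1, 2, 2, 1, 2, 0])) (Split 0 6 (Endo [0, 1, 2, 3, 4, 0, 6]) (Endo [0, 1, 2,
   2, 1, 1, 0])))))))))) (Split 1 4 (Relabel [1, 0, 2, 3, 4, 5, 6]) (Split 2 4 (Split 3 4 (Split 0
   5 (Relabel [0, 1, 2, 3, 5, 4, 6]) (Split 1 5 (Relabel [0, 1, 2, 3, 5, 4, 6]) (Split 2 5 (Split
   3 5 (Split 4 5 (Split 0 6 (Relabel [0, 1, 2, 3, 4, 6, 5]) (Split 1 6 (Relabel [0, 1, 2, 3, 4,
   6, 5]) (Endo [4, 5, 2, 3, 4, 5, 6]))) (Split 0 6 (Endo [0, 1, 2, 3, 0, 5, 6]) (Endo [0, 1, 2,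
   2, 1, 1, 0]))) (Split 4 5 (Split 0 6 (Relabel [0, 1, 2, 3, 4, 6, 5]) (Split 1 6 (Relabel [0, 1,
   2, 3, 4, 6, 5]) (Split 2 6 (Endo [0, 1, 2, 2, 4, 5, 6]) (Split 3 6 (Split 4 6 (Split 5 6
   (Relabel [4, 5, 2, 6, 3, 0, 1]) (Endo [0, 1, 2, 2, 0, 1, 1])) (Endo [0, 1, 2, 3, 4, 5, 4]))
   (Endo [0, 1, 2, 2, 4, 5, 6]))))) (Split 0 6 (Endo [0, 1, 2, 3, 0, 5, 6]) (Endo [0, 1, 2, 2, 1,
   1, 0])))) (Split 3 5 (Relabel [0, 1, 3, 2, 4, 5, 6]) (Split 4 5 (Split 0 6 (Relabel [0, 1, 2,
   3, 4, 6, 5]) (Endo [0, 1, 2, 2, 1, 2, 0])) (Split 0 6 (Endo [0, 1, 2, 3, 0, 5, 6]) (Endo [0, 1,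
   2, 2, 1, 1, 0]))))))) (Split 0 5 (Relabel [0, 1, 2, 3, 5, 4, 6]) (Split 1 5 (Relabel [0, 1, 2,
   3, 5, 4, 6]) (Split 2 5 (Split 3 5 (Relabel [0, 1, 2, 3, 5, 4, 6]) (Split 4 5 (Split 0 6
   (Relabel [0, 1, 2, 3, 4, 6, 5]) (Split 1 6 (Relabel [0, 1, 2, 3, 4, 6, 5]) (Split 2 6 (Endo [0,
   1, 2, 2, 4, 5, 6]) (Split 3 6 (Split 4 6 (Split 5 6 (Rigid [(0, 2), (2, 4), (1, 5), (0, 4), (0,
   6), (1, 2), (0, 5), (1, 4), (1, 6), (2, 5), (3, 4), (3, 5), (0, 1), (1, 0), (2, 0), (4, 2), (0,
   3), (1, 3), (2, 1), (2, 6), (5, 0), (2, 3), (4, 1), (4, 3), (4, 6), (5, 1), (4, 0), (5, 2), (4,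
   5), (5, 3), (5, 4), (5, 6), (6, 0), (3, 1), (3, 2), (6, 1), (3, 0), (6, 2), (6, 3), (3, 6), (6,
   4), (6, 5)]) (Endo [0, 1, 2, 2, 0, 1, 1])) (Endo [0, 1, 2, 2, 0, 1, 0])) (Endo [0, 1, 2, 2, 4,
   5, 6]))))) (Split 0 6 (Endo [0, 1, 2, 3, 0, 5, 6]) (Endo [0, 1, 2, 2, 1, 1, 0])))) (Split 3 5
   (Split 4 5 (Split 0 6 (Relabel [0, 1, 2, 3, 4, 6, 5]) (Split 1 6 (Relabel [0, 1, 2, 3, 4, 6,
   5]) (Split 2 6 (Relabel [0, 1, 2, 3, 4, 6, 5]) (Split 3 6 (Relabel [0, 1, 3, 2, 5, 4, 6]) (Endo
   [0, 1, 2, 2, 0, 1, 2]))))) (Split 0 6 (Endo [0, 1, 2, 3, 0, 5, 6]) (Endo [0, 1, 2, 2, 1, 1,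
   0]))) (Split 4 5 (Split 0 6 (Relabel [0, 1, 2, 3, 4, 6, 5]) (Endo [0, 1, 2, 2, 1, 2, 0]))
   (Split 0 6 (Endo [0, 1, 2, 3, 0, 5, 6]) (Endo [0, 1, 2, 2, 1, 1, 0])))))))) (Split 3 4 (Relabel
   [0, 1, 3, 2, 4, 5, 6]) (Split 0 5 (Relabel [0, 1, 2, 3, 5, 4, 6]) (Split 1 5 (Relabel [0, 1, 2,
   3, 5, 4, 6]) (Split 2 5 (Relabel [0, 1, 2, 3, 5, 4, 6]) (Split 3 5 (Relabel [0, 1, 2, 3, 5, 4,
   6]) (Split 4 5 (Split 0 6 (Relabel [0, 1, 2, 3, 4, 6, 5]) (Endo [0, 1, 2, 2, 1, 2, 0])) (Split
   0 6 (Endo [0, 1, 2, 3, 0, 5, 6]) (Endo [0, 1, 2, 2, 1, 1, 0])))))))))))) (Split 2 3 (Relabel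
   [0, 2, 1, 3, 4, 5, 6]) (Split 0 4 (Split 1 4 (Relabel [0, 1, 2, 4, 3, 5, 6]) (Split 2 4
   (Relabel [0, 1, 2, 4, 3, 5, 6]) (Split 3 4 (Split 0 5 (Split 1 5 (Relabel [0, 1, 2, 3, 5, 4,
   6]) (Split 2 5 (Relabel [0, 1, 2, 3, 5, 4, 6]) (Split 3 5 (Relabel [0, 3, 4, 1, 2, 5, 6])
   (Split 4 5 (Relabel [0, 1, 2, 4, 3, 5, 6]) (Split 0 6 (Split 1 6 (Endo [0, 1, 2, 3, 4, 1, 6])
   (Split 2 6 (Endo [0, 6, 2, 3, 4, 5, 6]) (Endo [0, 3, 4, 3, 4, 5, 6]))) (Endo [0, 1, 2, 3, 4, 5,
   0])))))) (Split 1 5 (Split 2 5 (Relabel [1, 0, 2, 5, 4, 3, 6]) (Split 3 5 (Split 4 5 (Relabel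
   [0, 3, 4, 1, 2, 5, 6]) (Split 0 6 (Endo [0, 1, 2, 3, 4, 0, 6]) (Endo [0, 1, 2, 1, 2, 2, 0])))
   (Split 4 5 (Relabel [0, 1, 2, 4, 3, 5, 6]) (Split 0 6 (Endo [0, 1, 2, 3, 4, 0, 6]) (Endo [0, 1,
   2, 1, 2, 2, 0]))))) (Split 2 5 (Relabel [0, 2, 1, 3, 4, 5, 6]) (Split 3 5 (Relabel [0, 3, 4, 1,
   2, 5, 6]) (Split 4 5 (Relabel [0, 1, 2, 4, 3, 5, 6]) (Split 0 6 (Endo [0, 1, 2, 3, 4, 0, 6])
   (Endo [0, 1, 2, 1, 2, 1, 0]))))))) (Split 0 5 (Split 1 5 (Relabel [0, 1, 2, 3, 5, 4, 6]) (Split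
   2 5 (Relabel [0, 1, 2, 3, 5, 4, 6]) (Split 3 5 (Relabel [0, 1, 2, 3, 5, 4, 6]) (Split 4 5
   (Relabel [0, 1, 2, 4, 3, 5, 6]) (Split 0 6 (Split 1 6 (Endo [0, 1, 2, 1, 4, 5, 6]) (Endo [0, 1,
   2, 2, 2, 2, 1])) (Endo [0, 1, 2, 3, 4, 5, 0])))))) (Split 1 5 (Split 2 5 (Relabel [1, 0, 2, 5,
   4, 3, 6]) (Split 3 5 (Split 4 5 (Split 0 6 (Endo [0, 1, 2, 3, 4, 0, 6]) (Endo [0, 1, 2, 1, 1,
   2, 0])) (Split 0 6 (Endo [0, 1, 2, 3, 4, 0, 6]) (Endo [0, 1, 2, 1, 1, 2, 0]))) (Split 4 5
   (Relabel [0, 1, 2, 4, 3, 5, 6]) (Split 0 6 (Endo [0, 1, 2, 3, 4, 0, 6]) (Endo [0, 1, 2, 1, 1,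
   2, 0]))))) (Split 2 5 (Relabel [0, 2, 1, 3, 4, 5, 6]) (Split 3 5 (Split 4 5 (Split 0 6 (Endo
   [0, 1, 2, 3, 4, 0, 6]) (Endo [0, 1, 2, 1, 1, 2, 0])) (Split 0 6 (Endo [0, 1, 2, 3, 4, 0, 6])
   (Endo [0, 1, 2, 1, 1, 2, 0]))) (Split 4 5 (Relabel [0, 1, 2, 4, 3, 5, 6]) (Split 0 6 (Endo [0,
   1, 2, 3, 4, 0, 6]) (Endo [0, 1, 2, 1, 1, 1, 0])))))))))) (Split 1 4 (Split 2 4 (Relabel [1, 0,
   2, 4, 3, 5, 6]) (Split 3 4 (Split 0 5 (Relabel [0, 1, 2, 3, 5, 4, 6]) (Split 1 5 (Relabel [1,
   0, 2, 4, 3, 5, 6]) (Split 2 5 (Split 3 5 (Split 4 5 (Split 0 6 (Relabel [0, 1, 2, 3, 4, 6, 5])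
   (Split 1 6 (Relabel [0, 1, 2, 3, 4, 6, 5]) (Split 2 6 (Relabel [0, 2, 1, 3, 5, 4, 6]) (Endo [4,
   5, 3, 3, 4, 5, 6])))) (Split 0 6 (Endo [0, 1, 2, 3, 0, 5, 6]) (Split 1 6 (Relabel [0, 1, 2, 3,
   4, 6, 5]) (Endo [0, 1, 2, 2, 0, 0, 1])))) (Split 4 5 (Relabel [1, 0, 2, 4, 3, 5, 6]) (Split 0 6
   (Endo [0, 1, 2, 3, 0, 5, 6]) (Endo [0, 1, 2, 1, 2, 1, 0])))) (Split 3 5 (Split 4 5 (Split 0 6
   (Relabel [0, 1, 2, 3, 4, 6, 5]) (Split 1 6 (Relabel [0, 1, 2, 3, 4, 6, 5]) (Split 2 6 (Relabel
   [0, 1, 2, 3, 4, 6, 5]) (Endo [4, 3, 5, 3, 4, 5, 6])))) (Split 0 6 (Endo [0, 1, 2, 3, 0, 5, 6])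
   (Endo [0, 1, 2, 1, 2, 2, 0]))) (Split 4 5 (Relabel [1, 0, 2, 4, 3, 5, 6]) (Split 0 6 (Endo [0,
   1, 2, 3, 0, 5, 6]) (Endo [0, 1, 2, 1, 2, 1, 0]))))))) (Split 0 5 (Relabel [0, 1, 2, 3, 5, 4,
   6]) (Split 1 5 (Relabel [1, 0, 2, 4, 3, 5, 6]) (Split 2 5 (Split 3 5 (Relabel [0, 2, 1, 3, 5,
   4, 6]) (Split 4 5 (Relabel [1, 0, 2, 4, 3, 5, 6]) (Split 0 6 (Endo [0, 1, 2, 3, 0, 5, 6]) (Endo
   [0, 1, 2, 1, 2, 1, 0])))) (Split 3 5 (Split 4 5 (Split 0 6 (Relabel [0, 1, 2, 3, 4, 6, 5])
   (Endo [0, 1, 2, 2, 2, 1, 0])) (Split 0 6 (Endo [0, 1, 2, 3, 0, 5, 6]) (Endo [0, 1, 2, 1, 2, 2,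
   0]))) (Split 4 5 (Relabel [1, 0, 2, 4, 3, 5, 6]) (Split 0 6 (Endo [0, 1, 2, 3, 0, 5, 6]) (Endo
   [0, 1, 2, 1, 2, 1, 0]))))))))) (Split 2 4 (Relabel [0, 2, 1, 3, 4, 5, 6]) (Split 3 4 (Split 0 5
   (Relabel [0, 1, 2, 3, 5, 4, 6]) (Split 1 5 (Relabel [0, 1, 2, 3, 5, 4, 6]) (Split 2 5 (Relabel
   [0, 1, 2, 3, 5, 4, 6]) (Split 3 5 (Split 4 5 (Split 0 6 (Relabel [0, 1, 2, 3, 4, 6, 5]) (Split
   1 6 (Relabel [0, 1, 2, 3, 4, 6, 5]) (Split 2 6 (Relabel [0, 1, 2, 3, 4, 6, 5]) (Endo [4, 3, 5,
   3, 4, 5, 6])))) (Split 0 6 (Endo [0, 1, 2, 3, 0, 5, 6]) (Endo [0, 1, 2, 1, 2, 2, 0]))) (Split 4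
   5 (Split 0 6 (Relabel [0, 1, 2, 3, 4, 6, 5]) (Endo [0, 1, 2, 1, 2, 1, 0])) (Split 0 6 (Endo [0,
   1, 2, 3, 0, 5, 6]) (Endo [0, 1, 2, 1, 2, 1, 0]))))))) (Split 0 5 (Relabel [0, 1, 2, 3, 5, 4,
   6]) (Split 1 5 (Relabel [0, 1, 2, 3, 5, 4, 6]) (Split 2 5 (Relabel [0, 1, 2, 3, 5, 4, 6])
   (Split 3 5 (Relabel [0, 1, 2, 3, 5, 4, 6]) (Split 4 5 (Split 0 6 (Relabel [0, 1, 2, 3, 4, 6,
   5]) (Endo [0, 1, 2, 1, 1, 2, 0])) (Split 0 6 (Endo [0, 1, 2, 3, 0, 5, 6]) (Endo [0, 1, 2, 1, 1,
   1, 0]))))))))))))) (Split 1 3 (Relabel [1, 0, 2, 3, 4, 5, 6]) (Split 2 3 (Relabel [0, 2, 1, 3,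
   4, 5, 6]) (Split 0 4 (Relabel [0, 1, 2, 4, 3, 5, 6]) (Split 1 4 (Relabel [0, 1, 2, 4, 3, 5, 6])
   (Split 2 4 (Relabel [0, 1, 2, 4, 3, 5, 6]) (Split 3 4 (Split 0 5 (Relabel [0, 1, 2, 3, 5, 4,
   6]) (Split 1 5 (Relabel [0, 1, 2, 3, 5, 4, 6]) (Split 2 5 (Relabel [0, 1, 2, 3, 5, 4, 6])
   (Split 3 5 (Split 4 5 (Split 0 6 (Relabel [0, 1, 2, 3, 4, 6, 5]) (Split 1 6 (Relabel [0, 1, 2,
   3, 4, 6, 5]) (Split 2 6 (Relabel [0, 1, 2, 3, 4, 6, 5]) (Endo [3, 4, 5, 3, 4, 5, 6])))) (Split
   0 6 (Relabel [0, 1, 2, 3, 4, 6, 5]) (Endo [0, 1, 2, 1, 2, 2, 0]))) (Split 4 5 (Relabel [0, 1,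
   2, 4, 3, 5, 6]) (Split 0 6 (Endo [0, 1, 2, 3, 4, 0, 6]) (Endo [0, 1, 2, 1, 2, 1, 0])))))))
   (Split 0 5 (Relabel [0, 1, 2, 3, 5, 4, 6]) (Split 1 5 (Relabel [0, 1, 2, 3, 5, 4, 6]) (Split 2
   5 (Relabel [0, 1, 2, 3, 5, 4, 6]) (Split 3 5 (Relabel [0, 1, 2, 3, 5, 4, 6]) (Split 4 5
   (Relabel [0, 1, 2, 4, 3, 5, 6]) (Split 0 6 (Endo [0, 1, 2, 0, 4, 5, 6]) (Endo [0, 1, 2, 1, 1,
   1, 0])))))))))))))) (Split 0 3 (Split 1 3 (Relabel [0, 1, 3, 2, 4, 5, 6]) (Split 2 3 (Relabel
   [0, 2, 1, 3, 4, 5, 6]) (Split 0 4 (Split 1 4 (Relabel [0, 1, 2, 4, 3, 5, 6]) (Split 2 4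
   (Relabel [0, 1, 2, 4, 3, 5, 6]) (Split 3 4 (Relabel [0, 1, 3, 2, 4, 5, 6]) (Split 0 5 (Split 1
   5 (Relabel [0, 1, 2, 3, 5, 4, 6]) (Split 2 5 (Relabel [0, 1, 2, 3, 5, 4, 6]) (Split 3 5
   (Relabel [0, 1, 2, 3, 5, 4, 6]) (Split 4 5 (Relabel [0, 1, 2, 4, 3, 5, 6]) (Split 0 6 (Split 1
   6 (Endo [0, 1, 1, 3, 4, 5, 6]) (Endo [0, 2, 2, 3, 4, 5, 6])) (Endo [0, 1, 2, 3, 4, 5, 0]))))))
   (Split 1 5 (Split 2 5 (Split 3 5 (Split 4 5 (Split 0 6 (Endo [0, 1, 2, 3, 4, 0, 6]) (Endo [5,
   1, 2, 3, 4, 5, 6])) (Split 0 6 (Endo [0, 1, 2, 3, 4, 0, 6]) (Split 1 6 (Endo [0, 1, 1, 3, 4, 5,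
   6]) (Endo [0, 2, 2, 3, 4, 5, 6])))) (Split 4 5 (Relabel [0, 1, 2, 4, 3, 5, 6]) (Split 0 6 (Endo
   [0, 1, 2, 3, 4, 0, 6]) (Split 1 6 (Endo [0, 1, 1, 3, 4, 5, 6]) (Endo [0, 2, 2, 3, 4, 5, 6])))))
   (Split 3 5 (Relabel [0, 1, 3, 2, 4, 5, 6]) (Split 4 5 (Relabel [0, 1, 2, 4, 3, 5, 6]) (Split 0
   6 (Endo [0, 1, 2, 3, 4, 0, 6]) (Split 1 6 (Endo [0, 1, 1, 3, 4, 5, 6]) (Split 2 6 (Endo [0, 1,
   2, 2, 4, 5, 6]) (Endo [0, 1, 1, 3, 4, 5, 6]))))))) (Split 2 5 (Relabel [0, 2, 1, 3, 4, 5, 6])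
   (Split 3 5 (Relabel [0, 1, 3, 2, 4, 5, 6]) (Split 4 5 (Relabel [0, 1, 2, 4, 3, 5, 6]) (Split 0
   6 (Endo [0, 1, 2, 3, 4, 0, 6]) (Endo [0, 1, 1, 1, 1, 1, 0])))))))))) (Split 1 4 (Split 2 4
   (Split 3 4 (Split 0 5 (Relabel [0, 1, 2, 3, 5, 4, 6]) (Split 1 5 (Split 2 5 (Split 3 5 (Split 4
   5 (Relabel [4, 1, 2, 3, 0, 5, 6]) (Split 0 6 (Endo [0, 1, 2, 3, 0, 5, 6]) (Endo [4, 1, 2, 3, 4,
   5, 6]))) (Split 4 5 (Relabel [4, 1, 2, 3, 0, 5, 6]) (Split 0 6 (Endo [0, 1, 2, 3, 0, 5, 6])
   (Endo [4, 1, 2, 3, 4, 5, 6])))) (Split 3 5 (Relabel [0, 1, 3, 2, 4, 5, 6]) (Split 4 5 (Relabel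
   [4, 1, 2, 3, 0, 5, 6]) (Split 0 6 (Endo [0, 1, 2, 3, 0, 5, 6]) (Endo [4, 1, 2, 3, 4, 5, 6])))))
   (Split 2 5 (Relabel [0, 2, 1, 3, 4, 5, 6]) (Split 3 5 (Relabel [0, 1, 3, 2, 4, 5, 6]) (Split 4
   5 (Relabel [4, 1, 2, 3, 0, 5, 6]) (Split 0 6 (Endo [0, 1, 2, 3, 0, 5, 6]) (Endo [4, 1, 2, 3, 4,
   5, 6]))))))) (Split 0 5 (Relabel [0, 1, 2, 3, 5, 4, 6]) (Split 1 5 (Split 2 5 (Split 3 5
   (Relabel [0, 1, 2, 3, 5, 4, 6]) (Split 4 5 (Relabel [4, 1, 2, 5, 0, 3, 6]) (Relabel [1, 0, 4,
   5, 2, 3, 6]))) (Split 3 5 (Split 4 5 (Relabel [4, 1, 2, 5, 0, 3, 6]) (Split 0 6 (Endo [0, 1, 2,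
   3, 0, 5, 6]) (Split 1 6 (Endo [0, 1, 1, 3, 4, 5, 6]) (Split 2 6 (Split 3 6 (Split 4 6 (Endo [0,
   1, 2, 2, 4, 4, 6]) (Endo [0, 1, 2, 3, 0, 5, 6])) (Endo [0, 1, 2, 1, 4, 5, 6])) (Endo [0, 1, 1,
   3, 4, 5, 6]))))) (Split 4 5 (Relabel [4, 1, 2, 5, 0, 3, 6]) (Split 0 6 (Endo [0, 1, 2, 3, 0, 5,
   6]) (Split 1 6 (Endo [0, 1, 1, 3, 4, 5, 6]) (Split 2 6 (Endo [0, 1, 2, 2, 4, 5, 6]) (Endo [0,
   1, 1, 3, 4, 5, 6]))))))) (Split 2 5 (Relabel [0, 2, 1, 3, 4, 5, 6]) (Split 3 5 (Split 4 5
   (Split 0 6 (Relabel [0, 1, 2, 3, 4, 6, 5]) (Split 1 6 (Endo [0, 1, 1, 3, 4, 5, 6]) (Endo [0, 2,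
   2, 3, 4, 5, 6]))) (Split 0 6 (Endo [0, 1, 2, 3, 0, 5, 6]) (Split 1 6 (Endo [0, 1, 1, 3, 4, 5,
   6]) (Endo [0, 2, 2, 3, 4, 5, 6])))) (Split 4 5 (Split 0 6 (Relabel [0, 1, 2, 3, 4, 6, 5])
   (Split 1 6 (Endo [0, 1, 1, 3, 4, 5, 6]) (Endo [0, 2, 2, 3, 4, 5, 6]))) (Split 0 6 (Endo [0, 1,
   2, 3, 0, 5, 6]) (Split 1 6 (Endo [0, 1, 1, 3, 4, 5, 6]) (Endo [0, 2, 2, 3, 4, 5, 6])))))))))
   (Split 3 4 (Relabel [0, 1, 3, 2, 4, 5, 6]) (Split 0 5 (Relabel [0, 1, 2, 3, 5, 4, 6]) (Split 1
   5 (Split 2 5 (Relabel [0, 1, 2, 3, 5, 4, 6]) (Split 3 5 (Relabel [0, 1, 2, 3, 5, 4, 6]) (Split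
   4 5 (Relabel [4, 1, 5, 3, 0, 2, 6]) (Split 0 6 (Endo [0, 1, 2, 3, 0, 5, 6]) (Split 1 6 (Endo
   [0, 1, 1, 3, 4, 5, 6]) (Split 2 6 (Endo [0, 1, 2, 2, 4, 5, 6]) (Endo [0, 1, 1, 3, 4, 5,
   6]))))))) (Split 2 5 (Split 3 5 (Relabel [0, 2, 1, 3, 5, 4, 6]) (Split 4 5 (Split 0 6 (Relabel
   [0, 1, 2, 3, 4, 6, 5]) (Split 1 6 (Endo [0, 1, 2, 1, 4, 5, 6]) (Split 2 6 (Endo [0, 1, 2, 2, 4,
   5, 6]) (Split 3 6 (Split 4 6 (Split 5 6 (Endo [4, 1, 5, 6, 4, 6, 5]) (Endo [0, 1, 2, 2, 4, 5,
   5])) (Endo [0, 1, 2, 1, 4, 5, 4])) (Endo [0, 1, 2, 1, 4, 5, 6]))))) (Split 0 6 (Endo [0, 1, 2,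
   3, 0, 5, 6]) (Split 1 6 (Endo [0, 1, 2, 1, 4, 5, 6]) (Split 2 6 (Endo [0, 1, 2, 2, 4, 5, 6])
   (Split 3 6 (Split 4 6 (Endo [0, 1, 1, 3, 4, 4, 6]) (Endo [0, 1, 2, 3, 0, 5, 6])) (Endo [0, 1,
   2, 1, 4, 5, 6]))))))) (Split 3 5 (Relabel [0, 1, 3, 2, 4, 5, 6]) (Split 4 5 (Split 0 6 (Relabel
   [0, 1, 2, 3, 4, 6, 5]) (Split 1 6 (Endo [0, 1, 1, 3, 4, 5, 6]) (Split 2 6 (Endo [0, 1, 2, 2, 4,
   5, 6]) (Endo [0, 1, 1, 3, 4, 5, 6])))) (Split 0 6 (Endo [0, 1, 2, 3, 0, 5, 6]) (Split 1 6 (Endo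
   [0, 1, 1, 3, 4, 5, 6]) (Split 2 6 (Endo [0, 1, 2, 2, 4, 5, 6]) (Endo [0, 1, 1, 3, 4, 5,
   6]))))))))))) (Split 2 4 (Relabel [0, 2, 1, 3, 4, 5, 6]) (Split 3 4 (Relabel [0, 1, 3, 2, 4, 5,
   6]) (Split 0 5 (Relabel [0, 1, 2, 3, 5, 4, 6]) (Split 1 5 (Relabel [0, 1, 2, 3, 5, 4, 6])
   (Split 2 5 (Relabel [0, 1, 2, 3, 5, 4, 6]) (Split 3 5 (Relabel [0, 1, 2, 3, 5, 4, 6]) (Split 4
   5 (Split 0 6 (Relabel [0, 1, 2, 3, 4, 6, 5]) (Split 1 6 (Endo [0, 1, 1, 3, 4, 5, 6]) (Endo [0,
   2, 2, 3, 4, 5, 6]))) (Split 0 6 (Endo [0, 1, 2, 3, 0, 5, 6]) (Endo [0, 1, 1, 1, 1, 1,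
   0]))))))))))))) (Split 1 3 (Split 2 3 (Split 0 4 (Relabel [0, 1, 2, 4, 3, 5, 6]) (Split 1 4
   (Relabel [1, 0, 3, 2, 4, 5, 6]) (Split 2 4 (Relabel [0, 2, 1, 3, 4, 5, 6]) (Split 3 4 (Relabel
   [3, 1, 2, 0, 4, 5, 6]) (Split 0 5 (Relabel [0, 1, 2, 3, 5, 4, 6]) (Split 1 5 (Relabel [0, 1, 2,
   3, 5, 4, 6]) (Split 2 5 (Relabel [0, 1, 2, 3, 5, 4, 6]) (Split 3 5 (Relabel [0, 1, 2, 3, 5, 4,
   6]) (Split 4 5 (Split 0 6 (Endo [0, 1, 2, 0, 4, 5, 6]) (Endo [3, 1, 2, 3, 4, 5, 6])) (Split 0 6
   (Endo [0, 1, 2, 0, 4, 5, 6]) (Endo [3, 1, 2, 3, 4, 5, 6]))))))))))) (Split 0 4 (Relabel [0, 1,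
   2, 4, 3, 5, 6]) (Split 1 4 (Relabel [1, 0, 3, 2, 4, 5, 6]) (Split 2 4 (Split 3 4 (Split 0 5
   (Relabel [0, 1, 2, 3, 5, 4, 6]) (Split 1 5 (Relabel [0, 1, 2, 3, 5, 4, 6]) (Split 2 5 (Relabel
   [0, 2, 1, 4, 3, 5, 6]) (Split 3 5 (Relabel [1, 0, 3, 2, 4, 5, 6]) (Split 4 5 (Relabel [0, 2, 1,
   4, 3, 5, 6]) (Split 0 6 (Endo [0, 1, 2, 3, 4, 0, 6]) (Split 1 6 (Endo [0, 1, 2, 3, 4, 1, 6])
   (Split 2 6 (Endo [0, 1, 2, 3, 4, 2, 6]) (Split 3 6 (Endo [0, 1, 2, 3, 4, 3, 6]) (Endo [0, 1, 2,
   3, 4, 0, 2])))))))))) (Split 0 5 (Relabel [0, 1, 2, 3, 5, 4, 6]) (Split 1 5 (Relabel [0, 1, 2,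
   3, 5, 4, 6]) (Split 2 5 (Relabel [0, 2, 1, 4, 3, 5, 6]) (Split 3 5 (Split 4 5 (Split 0 6
   (Relabel [0, 1, 2, 3, 4, 6, 5]) (Split 1 6 (Relabel [0, 1, 2, 3, 4, 6, 5]) (Endo [4, 5, 2, 3,
   4, 5, 6]))) (Split 0 6 (Endo [0, 1, 2, 3, 0, 5, 6]) (Split 1 6 (Endo [0, 1, 2, 3, 4, 1, 6])
   (Split 2 6 (Relabel [0, 1, 2, 3, 4, 6, 5]) (Split 3 6 (Endo [0, 1, 1, 3, 3, 5, 6]) (Split 4 6
   (Split 5 6 (Rigid [(1, 5), (3, 6), (0, 3), (2, 1), (4, 0), (5, 4), (6, 2), (1, 2), (3, 0), (5,
   1), (6, 3), (0, 4), (4, 5), (2, 6), (1, 4), (0, 2), (4, 1), (2, 0), (5, 0), (0, 5), (1, 3), (3,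
   1), (1, 6), (3, 4), (6, 0), (5, 2), (2, 5), (4, 6), (6, 4), (2, 3), (1, 0), (3, 2), (6, 5), (5,
   3), (4, 2), (0, 1), (2, 4), (3, 5), (6, 1), (4, 3), (0, 6), (5, 6)]) (Endo [0, 1, 2, 3, 4, 1,
   6])) (Endo [0, 1, 2, 3, 0, 5, 6]))))))) (Split 4 5 (Relabel [0, 2, 1, 4, 3, 5, 6]) (Split 0 6
   (Endo [0, 1, 2, 0, 4, 5, 6]) (Split 1 6 (Endo [0, 1, 2, 3, 4, 1, 6]) (Split 2 6 (Endo [0, 1, 2,
   3, 4, 2, 6]) (Endo [0, 1, 1, 0, 0, 0, 1])))))))))) (Split 3 4 (Relabel [1, 0, 3, 2, 4, 5, 6])
   (Split 0 5 (Relabel [0, 1, 2, 3, 5, 4, 6]) (Split 1 5 (Relabel [0, 1, 2, 3, 5, 4, 6]) (Split 2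
   5 (Relabel [0, 1, 2, 3, 5, 4, 6]) (Split 3 5 (Relabel [0, 1, 2, 3, 5, 4, 6]) (Split 4 5 (Split
   0 6 (Endo [0, 1, 2, 0, 4, 5, 6]) (Split 1 6 (Endo [0, 1, 1, 3, 4, 5, 6]) (Split 2 6 (Relabel
   [0, 1, 2, 3, 4, 6, 5]) (Endo [0, 1, 1, 3, 4, 5, 6])))) (Split 0 6 (Endo [0, 1, 2, 0, 4, 5, 6])
   (Split 1 6 (Endo [0, 1, 1, 3, 4, 5, 6]) (Split 2 6 (Endo [0, 1, 2, 3, 2, 5, 6]) (Endo [0, 1, 1,
   3, 4, 5, 6])))))))))))))) (Split 2 3 (Relabel [0, 2, 1, 3, 4, 5, 6]) (Split 0 4 (Relabel [0, 1,
   2, 4, 3, 5, 6]) (Split 1 4 (Relabel [0, 1, 2, 4, 3, 5, 6]) (Split 2 4 (Relabel [0, 1, 2, 4, 3,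
   5, 6]) (Split 3 4 (Split 0 5 (Relabel [0, 1, 2, 3, 5, 4, 6]) (Split 1 5 (Relabel [0, 1, 2, 3,
   5, 4, 6]) (Split 2 5 (Relabel [0, 1, 2, 3, 5, 4, 6]) (Split 3 5 (Split 4 5 (Relabel [3, 4, 5,
   0, 1, 2, 6]) (Split 0 6 (Relabel [0, 1, 2, 3, 4, 6, 5]) (Split 1 6 (Endo [0, 1, 1, 3, 4, 5, 6])
   (Endo [0, 2, 2, 3, 4, 5, 6])))) (Split 4 5 (Relabel [0, 1, 2, 4, 3, 5, 6]) (Split 0 6 (Endo [0,
   1, 2, 3, 4, 0, 6]) (Split 1 6 (Endo [0, 1, 1, 3, 4, 5, 6]) (Endo [0, 2, 2, 3, 4, 5, 6]))))))))
   (Split 0 5 (Relabel [0, 1, 2, 3, 5, 4, 6]) (Split 1 5 (Relabel [0, 1, 2, 3, 5, 4, 6]) (Split 2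
   5 (Relabel [0, 1, 2, 3, 5, 4, 6]) (Split 3 5 (Relabel [0, 1, 2, 3, 5, 4, 6]) (Split 4 5
   (Relabel [0, 1, 2, 4, 3, 5, 6]) (Split 0 6 (Endo [0, 1, 2, 0, 4, 5, 6]) (Endo [0, 1, 1, 1, 1,
   1, 0]))))))))))))))) (Split 1 2 (Relabel [1, 0, 2, 3, 4, 5, 6]) (Split 0 3 (Relabel [0, 1, 3,
   2, 4, 5, 6]) (Split 1 3 (Relabel [0, 1, 3, 2, 4, 5, 6]) (Split 2 3 (Split 0 4 (Relabel [0, 1,
   2, 4, 3, 5, 6]) (Split 1 4 (Relabel [0, 1, 2, 4, 3, 5, 6]) (Split 2 4 (Relabel [2, 3, 0, 1, 4,
   5, 6]) (Split 3 4 (Relabel [0, 1, 3, 2, 4, 5, 6]) (Split 0 5 (Relabel [0, 1, 2, 3, 5, 4, 6])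
   (Split 1 5 (Relabel [0, 1, 2, 3, 5, 4, 6]) (Split 2 5 (Relabel [0, 1, 2, 3, 5, 4, 6]) (Split 3
   5 (Relabel [0, 1, 2, 3, 5, 4, 6]) (Split 4 5 (Split 0 6 (Relabel [0, 1, 2, 3, 4, 6, 5]) (Split
   1 6 (Endo [6, 1, 2, 3, 4, 5, 6]) (Endo [2, 3, 2, 3, 4, 5, 6]))) (Split 0 6 (Endo [0, 1, 2, 3,
   0, 5, 6]) (Split 1 6 (Endo [6, 1, 2, 3, 4, 5, 6]) (Endo [2, 3, 2, 3, 4, 5, 6]))))))))))))
   (Split 0 4 (Relabel [0, 1, 2, 4, 3, 5, 6]) (Split 1 4 (Relabel [0, 1, 2, 4, 3, 5, 6]) (Split 2
   4 (Relabel [0, 1, 2, 4, 3, 5, 6]) (Split 3 4 (Relabel [0, 1, 3, 2, 4, 5, 6]) (Split 0 5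
   (Relabel [0, 1, 2, 3, 5, 4, 6]) (Split 1 5 (Relabel [0, 1, 2, 3, 5, 4, 6]) (Split 2 5 (Relabel
   [0, 1, 2, 3, 5, 4, 6]) (Split 3 5 (Relabel [0, 1, 2, 3, 5, 4, 6]) (Split 4 5 (Relabel [0, 1, 2,
   4, 3, 5, 6]) (Split 0 6 (Endo [0, 1, 0, 3, 4, 5, 6]) (Endo [0, 1, 1, 1, 1, 1,
   0])))))))))))))))) (Split 0 2 (Relabel [0, 2, 1, 3, 4, 5, 6]) (Split 1 2 (Relabel [1, 0, 2, 3,
   4, 5, 6]) (Split 0 3 (Relabel [0, 1, 3, 2, 4, 5, 6]) (Split 1 3 (Relabel [0, 1, 3, 2, 4, 5, 6])
   (Split 2 3 (Relabel [0, 2, 1, 3, 4, 5, 6]) (Split 0 4 (Relabel [0, 1, 2, 4, 3, 5, 6]) (Split 1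
   4 (Relabel [0, 1, 2, 4, 3, 5, 6]) (Split 2 4 (Relabel [0, 1, 2, 4, 3, 5, 6]) (Split 3 4
   (Relabel [0, 1, 3, 2, 4, 5, 6]) (Split 0 5 (Relabel [0, 1, 2, 3, 5, 4, 6]) (Split 1 5 (Relabel
   [0, 1, 2, 3, 5, 4, 6]) (Split 2 5 (Relabel [0, 1, 2, 3, 5, 4, 6]) (Split 3 5 (Relabel [0, 1, 2,
   3, 5, 4, 6]) (Split 4 5 (Relabel [0, 1, 2, 4, 3, 5, 6]) (Split 0 6 (Endo [0, 0, 2, 3, 4, 5, 6])
   (Endo [1, 1, 2, 3, 4, 5, 6]))))))))))))))))"

lemma check_cores7: "check_core 7 cores7 [] []"
  unfolding cores7_def by code_simp

section \<open>Reduction to binary polymorphisms\<close>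

locale connected_core = pair_graph H for H :: "'a pair_pre_digraph" +
  assumes connected: "connected (with_proj H)"
    and core: "is_core H"
    and card_ge_3: "3 \<le> card (pverts H)"
begin

abbreviation "V \<equiv> pverts H"
abbreviation "E \<equiv> parcs H"

section \<open>Neighbourhoods and two-colourings of a core\<close>

lemma arc_sym: "(u, v) \<in> E \<Longrightarrow> (v, u) \<in> E"
  using arcs_symmetric by blast

lemma arc_irrefl: "(u, u) \<notin> E"
  using no_loops by fastforce

lemma arc_verts: "(u, v) \<in> E \<Longrightarrow> u \<in> V \<and> v \<in> V"
  by (blast dest: in_arcsD1 in_arcsD2)

lemma endo_bij:
  assumes "\<And>u. u \<in> V \<Longrightarrow> f u \<in> V" "\<And>u v. (u, v) \<in> E \<Longrightarrow> (f u, f v) \<in> E"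
  shows "bij_betw f V V"
  using core assms by (auto simp: is_core_def graph_hom_def)

text \<open>Folding \<open>u\<close> onto \<open>v\<close> is an endomorphism, and it is injective
  only if the two vertices coincide. Later proofs identify a vertex by showing one inclusion of
  neighbourhoods.\<close>

lemma nbhd_subset_imp_eq:
  assumes "u \<in> V" "v \<in> V" "\<And>w. (u, w) \<in> E \<Longrightarrow> (v, w) \<in> E"
  shows "u = v"
proof (rule ccontr)
  assume "u \<noteq> v"
  have "bij_betw (\<lambda>w. if w = u then v else w) V V"
  proof (rule endo_bij)
    fix x y assume "(x, y) \<in> E"
    then show "(if x = u then v else x, if y = u then v else y) \<in> E"
      using assms(3)[of y] assms(3)[of x] arc_irrefl[of u] arc_sym[of x y] arc_sym[of v x]
      by (cases "x = u"; cases "y = u") auto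
  qed (use assms in auto)
  then have "inj_on (\<lambda>w. if w = u then v else w) V"
    by (rule bij_betw_imp_inj_on)
  from inj_onD[OF this, of u v] show False
    using assms(1,2) \<open>u \<noteq> v\<close> by simp
qed

lemma ex_other: "\<exists>v \<in> V. v \<noteq> u"
proof (rule ccontr)
  assume "\<not> ?thesis"
  then have "V \<subseteq> {u}" by auto
  then have "card V \<le> card {u}" by (intro card_mono) auto
  with card_ge_3 show False by simp
qed

text \<open>The empty neighbourhood of an isolated vertex would be included in that of any other
  vertex.\<close>

lemma ex_nbr:
  assumes "u \<in> V"
  shows "\<exists>w. (u, w) \<in> E"
  using ex_other[of u] nbhd_subset_imp_eq[OF assms] by blast

text \<open>A proper two-colouring gives an endomorphism onto the two ends of one edge, which is not
  surjective on three or more vertices.\<close>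

lemma not_two_colourable:
  fixes c :: "'a \<Rightarrow> bool"
  assumes "\<And>u v. (u, v) \<in> E \<Longrightarrow> c u \<noteq> c v"
  shows False
proof -
  obtain u0 where "u0 \<in> V" using ex_other by blast
  then obtain p q where pq: "(p, q) \<in> E" using ex_nbr by blast
  have "bij_betw (\<lambda>u. if c u then p else q) V V"
    using assms pq arc_sym arc_verts by (intro endo_bij) auto
  then have "V = (\<lambda>u. if c u then p else q) ` V"
    by (simp add: bij_betw_def)
  then have "V \<subseteq> {p, q}" by auto
  then have "card V \<le> card {p, q}" by (intro card_mono) auto
  also have "\<dots> \<le> 2" by (simp add: card_insert_if)
  finally show False using card_ge_3 by simp
qed

section \<open>Walks and their parity\<close>

lemma relpow_sym: "(u, v) \<in> E ^^ k \<Longrightarrow> (v, u) \<in> E ^^ k"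
proof (induction k arbitrary: v)
  case (Suc k)
  then obtain w where "(u, w) \<in> E ^^ k" "(w, v) \<in> E" by auto
  then show ?case using Suc.IH arc_sym by (metis relpow_Suc_I2)
qed auto

lemma relpow_trans: "(u, v) \<in> E ^^ k \<Longrightarrow> (v, w) \<in> E ^^ l \<Longrightarrow> (u, w) \<in> E ^^ (k + l)"
  unfolding relpow_add by (rule relcompI)

lemma ex_walk:
  assumes "u \<in> V" "v \<in> V"
  shows "\<exists>k. (u, v) \<in> E ^^ k"
proof -
  have "strongly_connected (with_proj H)"
    using connected sym_arcs by (rule symmetric_connected_imp_strongly_connected[rotated])
  then have "u \<rightarrow>\<^sup>*\<^bsub>with_proj H\<^esub> v"
    using assms by (auto simp: strongly_connected_def)
  then have "(u, v) \<in> E\<^sup>*"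
    using rtrancl_on_rtranclI by (auto simp: reachable_def)
  then show ?thesis using rtrancl_imp_relpow by blast
qed

text \<open>Colouring vertices by the existence of an even walk from \<open>u\<close> cannot be
  proper. An edge with ends of one colour closes two walks of equal parity to an odd closed
  walk.\<close>

lemma ex_odd_closed_walk: "\<exists>u \<in> V. \<exists>k. odd k \<and> (u, u) \<in> E ^^ k"
proof -
  obtain u where u: "u \<in> V" using ex_other by blast
  define c where "c v \<longleftrightarrow> (\<exists>k. even k \<and> (u, v) \<in> E ^^ k)" for v
  obtain v w where vw: "(v, w) \<in> E" "c v = c w"
    using not_two_colourable[of c] by blast
  have "\<exists>k l. (u, v) \<in> E ^^ k \<and> (u, w) \<in> E ^^ l \<and> even (k + l)"
  proof (cases "c v")
    case True
    with vw show ?thesis by (metis c_def even_add)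
  next
    \<comment> \<open>Neither end has an even walk from \<open>u\<close>, so any walks to them are
      both odd.\<close>
    case False
    moreover obtain k l where "(u, v) \<in> E ^^ k" "(u, w) \<in> E ^^ l"
      using ex_walk u vw(1) arc_verts by metis
    ultimately show ?thesis using vw by (metis c_def even_add)
  qed
  then obtain k l where kl: "(u, v) \<in> E ^^ k" "(u, w) \<in> E ^^ l" "even (k + l)" by blast
  have "(u, u) \<in> E ^^ (k + (1 + l))"
    using kl vw(1) relpow_sym relpow_trans by (metis relpow_1)
  moreover have "odd (k + (1 + l))" using kl(3) by simp
  ultimately show ?thesis using u by blast
qed

text \<open>A walk of the wrong parity is corrected by a detour around an odd closed walk.\<close>

lemma ex_even_walk:
  assumes "u \<in> V" "v \<in> V"
  shows "\<exists>k. (u, v) \<in> E ^^ (2 * k)"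
proof -
  obtain w k where w: "w \<in> V" "odd k" "(w, w) \<in> E ^^ k" using ex_odd_closed_walk by blast
  obtain i j where ij: "(u, w) \<in> E ^^ i" "(w, v) \<in> E ^^ j" using ex_walk assms w by metis
  have "(u, v) \<in> E ^^ (i + j)" "(u, v) \<in> E ^^ (i + k + j)"
    using ij w by (blast intro: relpow_trans)+
  moreover have "even (i + j) \<or> even (i + k + j)" using w(2) by presburger
  ultimately show ?thesis by (metis evenE)
qed

section \<open>Majority and Maltsev operations\<close>

lemma no_majority:
  assumes V: "\<And>x y z. \<lbrakk>x \<in> V; y \<in> V; z \<in> V\<rbrakk> \<Longrightarrow> g x y z \<in> V"
    and hom: "\<And>x y z x' y' z'. \<lbrakk>(x, x') \<in> E; (y, y') \<in> E; (z, z') \<in> E\<rbrakk> \<Longrightarrow> (g x y z, g x' y' z') \<in> E"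
    and maj: "\<And>x y. \<lbrakk>x \<in> V; y \<in> V\<rbrakk> \<Longrightarrow> g x x y = x \<and> g x y x = x \<and> g y x x = x"
  shows False
proof -
  have hom_walk: "(g x y z, g x' y' z') \<in> E ^^ k"
    if "(x, x') \<in> E ^^ k" "(y, y') \<in> E ^^ k" "(z, z') \<in> E ^^ k" for x y z x' y' z' k
    using that
  proof (induction k arbitrary: x' y' z')
    case (Suc k)
    then show ?case by (auto intro: hom relcompI)
  qed auto
  define P where "P k \<longleftrightarrow> odd k \<and> (\<exists>u \<in> V. (u, u) \<in> E ^^ k)" for k
  \<comment> \<open>This is the odd girth, as the least length of an odd closed walk.\<close>
  define k where "k = (LEAST k. P k)"
  have "\<exists>k. P k" using ex_odd_closed_walk by (auto simp: P_def)
  then have "P k" unfolding k_def by (rule LeastI_ex)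
  then obtain u where u: "odd k" "u \<in> V" "(u, u) \<in> E ^^ k" by (auto simp: P_def)
  have "k \<noteq> 1" using u arc_irrefl by auto
  \<comment> \<open>An odd \<open>k\<close> other than 1 is at least 3. Minimality of
    \<open>k\<close> makes walks of the odd length \<open>l = k - 2\<close> a relation without
    loops.\<close>
  then obtain l where l: "k = Suc (Suc l)" "odd l"
    using u(1) by (cases k; cases "k - 1") auto
  let ?R = "E ^^ l"
  have "l < (LEAST k. P k)" using l(1) k_def by linarith
  then have "\<not> P l" by (rule not_less_Least)
  then have R_irrefl: "(v, v) \<notin> ?R" if "v \<in> V" for v
    using that l(2) by (auto simp: P_def)
  \<comment> \<open>Going back and forth along an edge stretches it to any odd length.\<close>
  have E_R: "(v, w) \<in> ?R" if "(v, w) \<in> E" for v w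
  proof -
    have "(v, w) \<in> E ^^ (2 * i + 1)" for i
    proof (induction i)
      case (Suc i)
      have "(v, w) \<in> E ^^ (2 * i + 1 + (1 + 1))"
        using Suc that arc_sym by (metis relpow_1 relpow_trans)
      then show ?case by simp
    qed (use that in simp)
    then show ?thesis using l(2) by (metis oddE)
  qed
  \<comment> \<open>The shortest odd closed walk consists of two edges and \<open>l\<close> further
    steps, which close a triangle in \<open>?R\<close>.\<close>
  obtain a b where ab: "(u, a) \<in> E" "(a, b) \<in> E" "(b, u) \<in> ?R"
    using u(3) unfolding l(1) by (metis relpow_Suc_D2)
  define clique where "clique K \<longleftrightarrow> K \<subseteq> V \<and> (\<forall>x \<in> K. \<forall>y \<in> K. x \<noteq> y \<longrightarrow> (x, y) \<in> ?R)" for K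
  have "clique {u, a, b}"
    using ab u(2) E_R relpow_sym arc_verts by (auto simp: clique_def)
  moreover have "u \<noteq> a" "a \<noteq> b" "u \<noteq> b"
    using ab arc_irrefl R_irrefl u by auto
  then have "card {u, a, b} = 3" by simp
  ultimately have ex: "\<exists>K. clique K \<and> card K \<ge> 3" by (metis order_refl)
  define Q where "Q K \<longleftrightarrow> clique K \<and> card K \<ge> 3" for K
  have "\<forall>K. Q K \<longrightarrow> card K < Suc (card V)"
    using pair_finite_verts by (auto simp: Q_def clique_def less_Suc_eq_le intro: card_mono)
  \<comment> \<open>A clique of largest size; the contradiction will be a larger one.\<close>
  then obtain K where K: "Q K" "\<And>L. Q L \<Longrightarrow> card L \<le> card K"
    using ex_has_greatest_nat[of Q _ card "Suc (card V)"] ex unfolding Q_def by (metis less_imp_le)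
  have finK: "finite K" using K(1) pair_finite_verts by (auto simp: Q_def clique_def intro: finite_subset)
  obtain x y z where xyz: "x \<in> K" "y \<in> K" "z \<in> K" "x \<noteq> y" "y \<noteq> z" "x \<noteq> z"
  proof -
    obtain T where "T \<subseteq> K" "card T = 3" using K(1) obtain_subset_with_card_n unfolding Q_def by metis
    then show thesis using that by (auto simp: card_3_iff)
  qed
  have KV: "K \<subseteq> V" and KR: "\<And>x y. \<lbrakk>x \<in> K; y \<in> K; x \<noteq> y\<rbrakk> \<Longrightarrow> (x, y) \<in> ?R"
    using K(1) by (auto simp: Q_def clique_def)
  let ?d = "g x y z"
  have d_adj: "(e, ?d) \<in> ?R" if e: "e \<in> K" for e
  proof -
    \<comment> \<open>The vertex \<open>e\<close> is the value of \<open>g\<close> at a triple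
      adjacent to \<open>(x, y, z)\<close> in every coordinate. If \<open>e\<close> is one of the
      three, it is repeated at the two other positions and a different clique member stands at its
      own; otherwise the triple is constant.\<close>
    have "\<exists>x' y' z'. (x', x) \<in> ?R \<and> (y', y) \<in> ?R \<and> (z', z) \<in> ?R \<and> g x' y' z' = e"
    proof -
      consider "e = x" | "e = y" | "e = z" | "e \<notin> {x, y, z}" by blast
      then show ?thesis
      proof cases
        case 1
        then have "g y x x = e" using maj xyz KV by blast
        then show ?thesis using KR xyz by metis
      next
        case 2
        then have "g y x y = e" using maj xyz KV by blast
        then show ?thesis using KR xyz by metis
      next
        case 3
        then have "g z z x = e" using maj xyz KV by blast
        then show ?thesis using KR xyz by metis
      next
        case 4
        then have "g e e e = e" using maj e KV by blast
        then show ?thesis using KR xyz e 4 by (metis insertCI)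
      qed
    qed
    then show ?thesis using hom_walk by blast
  qed
  have dV: "?d \<in> V" using V xyz KV by blast
  \<comment> \<open>Were it in \<open>K\<close>, it would be \<open>?R\<close>-adjacent to
    itself.\<close>
  then have "?d \<notin> K" using d_adj R_irrefl by blast
  moreover have "clique (insert ?d K)"
    using KV KR d_adj dV relpow_sym by (auto simp: clique_def)
  ultimately have "Q (insert ?d K)" using K(1) finK by (auto simp: Q_def)
  from K(2)[OF this] show False using \<open>?d \<notin> K\<close> finK by simp
qed

text \<open>The operation turns every walk of length 3 into an edge. Vertices with a common
  neighbour then have the same neighbourhood and are equal, so degrees are at most 1 and a connected
  graph has at most two vertices.\<close>

lemma no_maltsev:
  assumes V: "\<And>x y z. \<lbrakk>x \<in> V; y \<in> V; z \<in> V\<rbrakk> \<Longrightarrow> g x y z \<in> V"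
    and hom: "\<And>x y z x' y' z'. \<lbrakk>(x, x') \<in> E; (y, y') \<in> E; (z, z') \<in> E\<rbrakk> \<Longrightarrow> (g x y z, g x' y' z') \<in> E"
    and mal: "\<And>x y. \<lbrakk>x \<in> V; y \<in> V\<rbrakk> \<Longrightarrow> g x y y = x \<and> g y y x = x"
  shows False
proof -
  \<comment> \<open>The edge joins \<open>g a c c = a\<close> to \<open>g b b d = d\<close>.\<close>
  have path3: "(a, d) \<in> E" if "(a, b) \<in> E" "(c, b) \<in> E" "(c, d) \<in> E" for a b c d
    using hom[of a b c b c d] mal that arc_verts by (metis)
  have nbr_unique: "a = c" if "(a, b) \<in> E" "(c, b) \<in> E" for a b c
    using nbhd_subset_imp_eq[of a c] path3[of c b a] that arc_verts by blast
  obtain a where a: "a \<in> V" using ex_other by blast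
  then obtain b where ab: "(a, b) \<in> E" using ex_nbr by blast
  have "v \<in> {a, b}" if "(a, v) \<in> E ^^ k" for v k
    using that
  proof (induction k arbitrary: v)
    case (Suc k)
    then obtain w where "w \<in> {a, b}" "(w, v) \<in> E" by auto
    then show ?case using ab nbr_unique arc_sym by blast
  qed auto
  then have "V \<subseteq> {a, b}" using ex_walk a by blast
  then have "card V \<le> card {a, b}" by (intro card_mono) auto
  also have "\<dots> \<le> 2" by (simp add: card_insert_if)
  finally show False using card_ge_3 by simp
qed

section \<open>Identification of variables and semiprojections\<close>

lemma power_verts_iff:
  "xs \<in> pverts (cross_power H m) \<longleftrightarrow> length xs = m \<and> (\<forall>i<m. xs ! i \<in> V)"
  by (auto simp: cross_power_def subset_eq all_set_conv_all_nth)

lemma polymorphism_iff: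
  "polymorphism H m f \<longleftrightarrow>
     (\<forall>xs. length xs = m \<and> (\<forall>i<m. xs ! i \<in> V) \<longrightarrow> f xs \<in> V) \<and>
     (\<forall>xs ys. length xs = m \<and> length ys = m \<and> (\<forall>i<m. (xs ! i, ys ! i) \<in> E) \<longrightarrow> (f xs, f ys) \<in> E)"
  by (auto simp: polymorphism_def graph_hom_def power_verts_iff)
    (auto simp: cross_power_def)

text \<open>Identifying variables \<open>i\<close> and \<open>j\<close> turns \<open>f\<close> into
  the projection to \<open>k\<close>. The index is ambiguous: if \<open>k\<close> is
  \<open>i\<close> or \<open>j\<close>, the other one serves as well.\<close>

definition coord :: "nat \<Rightarrow> ('a list \<Rightarrow> 'a) \<Rightarrow> nat \<Rightarrow> nat \<Rightarrow> nat \<Rightarrow> bool" where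
  "coord m f i j k \<longleftrightarrow>
     k < m \<and> (\<forall>xs. length xs = m \<and> (\<forall>t<m. xs ! t \<in> V) \<and> xs ! i = xs ! j \<longrightarrow> f xs = xs ! k)"

lemma identify_variables:
  assumes proj: "\<And>g. \<lbrakk>polymorphism H m g; idempotent H m g\<rbrakk> \<Longrightarrow> is_projection H m g"
    and f: "polymorphism H (Suc m) f" "idempotent H (Suc m) f"
    and ij: "i < Suc m" "j < Suc m" "i \<noteq> j"
  shows "\<exists>k. coord (Suc m) f i j k"
proof -
  \<comment> \<open>\<open>e\<close> embeds the \<open>m\<close> remaining positions by skipping
    \<open>j\<close>. \<open>d\<close> is its left inverse and sends \<open>j\<close> to the new
    place of \<open>i\<close>, which is \<open>i - 1\<close> if \<open>i\<close> lies behind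
    \<open>j\<close>.\<close>
  define e where "e s = (if s < j then s else Suc s)" for s
  define d where "d t = (if t < j then t else if t = j then (if i < j then i else i - 1) else t - 1)" for t
  define g where "g ys = f (map (\<lambda>t. ys ! d t) [0..<Suc m])" for ys
  have d: "d t < m" if "t < Suc m" for t
    using that ij by (auto simp: d_def)
  have e: "e s < Suc m" if "s < m" for s
    using that by (auto simp: e_def)
  have ed: "e (d t) = (if t = j then i else t)" if "t < Suc m" for t
    using that ij by (auto simp: d_def e_def)
  have "polymorphism H m g"
    using f(1) d by (auto simp: polymorphism_iff g_def simp del: upt_Suc)
  moreover have "idempotent H m g"
  proof -
    have "map (\<lambda>t. replicate m x ! d t) [0..<Suc m] = replicate (Suc m) x" for x :: 'a
      using d by (intro nth_equalityI) (auto simp del: upt_Suc replicate_Suc)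
    then show ?thesis
      using f(2) by (auto simp: idempotent_def g_def simp del: upt_Suc replicate_Suc)
  qed
  ultimately have "is_projection H m g" by (rule proj)
  then obtain k where k: "k < m"
    "\<And>ys. length ys = m \<Longrightarrow> (\<forall>t<m. ys ! t \<in> V) \<Longrightarrow> g ys = ys ! k"
    unfolding is_projection_def Ball_def power_verts_iff by blast
  have "f xs = xs ! e k" if xs: "length xs = Suc m" "\<forall>t<Suc m. xs ! t \<in> V" "xs ! i = xs ! j" for xs
  proof -
    let ?ys = "map (\<lambda>s. xs ! e s) [0..<m]"
    have "map (\<lambda>t. ?ys ! d t) [0..<Suc m] = xs"
      using xs d ed by (intro nth_equalityI) (auto simp del: upt_Suc)
    then have "f xs = g ?ys" by (simp add: g_def del: upt_Suc)
    also have "\<dots> = xs ! e k" using k xs e by simp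
    finally show ?thesis .
  qed
  then show ?thesis using e[OF k(1)] unfolding coord_def by blast
qed

text \<open>Induction on half the length of an even walk between the entries at two positions other
  than \<open>k\<close>. Adjacent tuples with a shorter walk show that every neighbour of
  \<open>xs ! k\<close> is a neighbour of \<open>f xs\<close>, so the two vertices are
  equal.\<close>

lemma semiprojection_imp_projection:
  assumes f: "polymorphism H m f" and m: "3 \<le> m" and k: "k < m"
    and semi: "\<And>i j. \<lbrakk>i < m; j < m; i \<noteq> j\<rbrakk> \<Longrightarrow> coord m f i j k"
  shows "is_projection H m f"
proof -
  obtain i j where ij: "i < m" "j < m" "i \<noteq> j" "i \<noteq> k" "j \<noteq> k"
  proof -
    have "\<exists>i j. i < m \<and> j < m \<and> i \<noteq> j \<and> i \<noteq> k \<and> j \<noteq> k"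
      using m by presburger
    then show thesis using that by blast
  qed
  have main: "f xs = xs ! k"
    if "length xs = m" "\<forall>t<m. xs ! t \<in> V" "(xs ! i, xs ! j) \<in> E ^^ (2 * r)" for xs r
    using that
  proof (induction r arbitrary: xs)
    case 0
    then show ?case using semi[of i j] ij by (auto simp: coord_def)
  next
    case (Suc r)
    \<comment> \<open>The first and the last edge are split off, one for each of the two
      positions.\<close>
    have "(xs ! i, xs ! j) \<in> E ^^ (1 + (2 * r + 1))" using Suc.prems(3) by simp
    then obtain a b where ab: "(xs ! i, a) \<in> E" "(a, b) \<in> E ^^ (2 * r)" "(b, xs ! j) \<in> E"
      unfolding relpow_add by auto
    obtain nb where nb: "\<And>u. u \<in> V \<Longrightarrow> (u, nb u) \<in> E" using ex_nbr by metis
    have "(f xs, w) \<in> E" if w: "(xs ! k, w) \<in> E" for w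
    proof -
      \<comment> \<open>Position \<open>k\<close> carries the given neighbour \<open>w\<close>,
        positions \<open>i\<close> and \<open>j\<close> move towards each other, and all others take
        an arbitrary neighbour.\<close>
      define ys where "ys = map (\<lambda>t. if t = k then w else if t = i then a
        else if t = j then b else nb (xs ! t)) [0..<m]"
      have arcs: "length ys = m" "\<forall>t<m. (xs ! t, ys ! t) \<in> E"
        using ab w nb Suc.prems(2) arc_sym by (auto simp: ys_def)
      then have "\<forall>t<m. ys ! t \<in> V" using arc_verts by blast
      moreover have "(ys ! i, ys ! j) \<in> E ^^ (2 * r)" using ab(2) ij by (simp add: ys_def)
      ultimately have "f ys = w" using Suc.IH[of ys] arcs(1) k by (simp add: ys_def)
      then show ?thesis using f arcs Suc.prems(1) by (auto simp: polymorphism_iff)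
    qed
    moreover have "f xs \<in> V" "xs ! k \<in> V"
      using f Suc.prems k by (auto simp: polymorphism_iff)
    ultimately show ?case using nbhd_subset_imp_eq[of "xs ! k" "f xs"] by simp
  qed
  have "f xs = xs ! k" if "length xs = m" "\<forall>t<m. xs ! t \<in> V" for xs
    using main[OF that] ex_even_walk[of "xs ! i" "xs ! j"] that(2) ij by blast
  then show ?thesis using k by (auto simp: is_projection_def power_verts_iff)
qed

text \<open>A tuple with value \<open>p\<close> on \<open>S\<close> and \<open>q\<close> elsewhere
  meets both identifications, so its entries at \<open>k\<close> and \<open>l\<close> agree.\<close>

lemma coord_separation:
  assumes "coord m f i j k" "coord m f i' j' l" "i < m" "j < m" "i' < m" "j' < m"
    and "i \<in> S \<longleftrightarrow> j \<in> S" "i' \<in> S \<longleftrightarrow> j' \<in> S"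
  shows "k \<in> S \<longleftrightarrow> l \<in> S"
proof -
  obtain p q where pq: "p \<in> V" "q \<in> V" "p \<noteq> q" using ex_other by metis
  let ?xs = "map (\<lambda>t. if t \<in> S then p else q) [0..<m]"
  have "length ?xs = m" "\<forall>t<m. ?xs ! t \<in> V" "?xs ! i = ?xs ! j" "?xs ! i' = ?xs ! j'"
    using assms(3-8) pq by simp_all
  then have "?xs ! k = ?xs ! l" "k < m" "l < m"
    using assms(1,2) unfolding coord_def by metis+
  then show ?thesis using pq by (simp split: if_splits)
qed

text \<open>Swierczkowski's lemma for arity at least 4. The disjoint pairs \<open>{0, 1}\<close> and
  \<open>{2, 3}\<close> fix a common \<open>k\<close>, which is then compared with the index of any
  other pair.\<close>

lemma common_coordinate:
  assumes m: "4 \<le> m"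
    and ex: "\<And>i j. \<lbrakk>i < m; j < m; i \<noteq> j\<rbrakk> \<Longrightarrow> \<exists>k. coord m f i j k"
  shows "\<exists>k<m. \<forall>i<m. \<forall>j<m. i \<noteq> j \<longrightarrow> coord m f i j k"
proof -
  have "\<exists>k. coord m f 0 1 k \<and> coord m f 2 3 k"
  proof -
    obtain k l where kl: "coord m f 0 1 k" "coord m f 2 3 l"
      using ex[of 0 1] ex[of 2 3] m by auto
    have sep: "k \<in> S \<longleftrightarrow> l \<in> S" if "0 \<in> S \<longleftrightarrow> 1 \<in> S" "2 \<in> S \<longleftrightarrow> 3 \<in> S" for S
      using coord_separation[OF kl _ _ _ _ that] m by simp
    \<comment> \<open>Either the indices agree, or they lie in one identified pair and are
      interchangeable there.\<close>
    have "k = l \<or> k \<in> {0, 1} \<and> l \<in> {0, 1} \<or> k \<in> {2, 3} \<and> l \<in> {2, 3}"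
      using sep[of "{0, 1}"] sep[of "{2, 3}"] sep[of "{l}"] by auto
    moreover have "coord m f 0 1 l" if "k \<in> {0, 1}" "l \<in> {0, 1}"
      using kl(1) that m by (auto simp: coord_def)
    moreover have "coord m f 2 3 k" if "k \<in> {2, 3}" "l \<in> {2, 3}"
      using kl(2) that m by (auto simp: coord_def)
    ultimately show ?thesis using kl by metis
  qed
  then obtain k where k: "coord m f 0 1 k" "coord m f 2 3 k" by blast
  have "coord m f i j k" if ij: "i < m" "j < m" "i \<noteq> j" for i j
  proof -
    obtain l where l: "coord m f i j l" using ex ij by blast
    have sep1: "k \<in> S \<longleftrightarrow> l \<in> S" if "0 \<in> S \<longleftrightarrow> 1 \<in> S" "i \<in> S \<longleftrightarrow> j \<in> S" for S
      using coord_separation[OF k(1) l _ _ ij(1,2) that] m by simp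
    have sep2: "k \<in> S \<longleftrightarrow> l \<in> S" if "2 \<in> S \<longleftrightarrow> 3 \<in> S" "i \<in> S \<longleftrightarrow> j \<in> S" for S
      using coord_separation[OF k(2) l _ _ ij(1,2) that] m by simp
    \<comment> \<open>A singleton outside \<open>{i, j}\<close> misses \<open>{0, 1}\<close> or
      \<open>{2, 3}\<close>, so it is an admissible separating set for one of them and forces
      \<open>k = l\<close>.\<close>
    have "k = l \<or> k \<in> {i, j} \<and> l \<in> {i, j}"
    proof (rule ccontr)
      assume neg: "\<not> ?thesis"
      then consider "l \<notin> {i, j}" | "k \<notin> {i, j}" by blast
      then show False
      proof cases
        case 1
        have "l = 0 \<or> l = 1" using sep1[of "{l}"] 1 neg by auto
        moreover have "l = 2 \<or> l = 3" using sep2[of "{l}"] 1 neg by auto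
        ultimately show False by auto
      next
        case 2
        have "k = 0 \<or> k = 1" using sep1[of "{k}"] 2 neg by auto
        moreover have "k = 2 \<or> k = 3" using sep2[of "{k}"] 2 neg by auto
        ultimately show False by auto
      qed
    qed
    then show ?thesis using l ij by (auto simp: coord_def)
  qed
  moreover have "k < m" using k by (simp add: coord_def)
  ultimately show ?thesis by blast
qed

text \<open>Each of the three identifications returns the repeated or the single entry. Three
  repeated entries form a majority operation, and two single entries form a Maltsev operation up to
  permutation. What remains is exactly one single entry, whose position is the common
  coordinate.\<close>

lemma ternary_common_coordinate:
  assumes f: "polymorphism H 3 f"
    and ex: "\<And>i j. \<lbrakk>i < 3; j < 3; i \<noteq> j\<rbrakk> \<Longrightarrow> \<exists>k. coord 3 f i j k"
  shows "\<exists>k<3. \<forall>i<3. \<forall>j<3. i \<noteq> j \<longrightarrow> coord 3 f i j k"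
proof -
  define g where "g x y z = f [x, y, z]" for x y z
  have less_3: "k < 3 \<longleftrightarrow> k = 0 \<or> k = 1 \<or> k = 2" for k :: nat by auto
  have all3: "(\<forall>t<3. P t) \<longleftrightarrow> P 0 \<and> P 1 \<and> P 2" for P :: "nat \<Rightarrow> bool"
    by (auto simp: less_3)
  have len3: "(\<forall>xs. length xs = 3 \<longrightarrow> Q xs) \<longleftrightarrow> (\<forall>x y z. Q [x, y, z])" for Q :: "'a list \<Rightarrow> bool"
    by (auto simp: numeral_3_eq_3 length_Suc_conv)
  have coord3: "coord 3 f i j k \<longleftrightarrow> k < 3 \<and> (\<forall>x y z. x \<in> V \<and> y \<in> V \<and> z \<in> V \<and>
      [x, y, z] ! i = [x, y, z] ! j \<longrightarrow> g x y z = [x, y, z] ! k)" for i j k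
    using len3[of "\<lambda>xs. (\<forall>t<3. xs ! t \<in> V) \<and> xs ! i = xs ! j \<longrightarrow> f xs = xs ! k"]
    by (simp add: coord_def all3 g_def imp_conjL)
  have V: "g x y z \<in> V" if "x \<in> V" "y \<in> V" "z \<in> V" for x y z
    using f that by (simp add: polymorphism_iff all3 g_def)
  have hom: "(g x y z, g x' y' z') \<in> E"
    if "(x, x') \<in> E" "(y, y') \<in> E" "(z, z') \<in> E" for x y z x' y' z'
    using f that by (simp add: polymorphism_iff all3 g_def)
  have c01: "(\<forall>x\<in>V. \<forall>y\<in>V. g x x y = x) \<or> (\<forall>x\<in>V. \<forall>y\<in>V. g x x y = y)"
  proof -
    obtain k where "coord 3 f 0 1 k" using ex[of 0 1] by auto
    then show ?thesis by (auto simp: coord3 less_3)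
  qed
  have c02: "(\<forall>x\<in>V. \<forall>y\<in>V. g x y x = x) \<or> (\<forall>x\<in>V. \<forall>y\<in>V. g x y x = y)"
  proof -
    obtain k where "coord 3 f 0 2 k" using ex[of 0 2] by auto
    then show ?thesis by (auto simp: coord3 less_3)
  qed
  have c12: "(\<forall>x\<in>V. \<forall>y\<in>V. g y x x = x) \<or> (\<forall>x\<in>V. \<forall>y\<in>V. g y x x = y)"
  proof -
    obtain k where "coord 3 f 1 2 k" using ex[of 1 2] by auto
    then show ?thesis by (auto simp: coord3 less_3)
  qed
  have not_maj: "\<not> ((\<forall>x\<in>V. \<forall>y\<in>V. g x x y = x) \<and> (\<forall>x\<in>V. \<forall>y\<in>V. g x y x = x) \<and>
      (\<forall>x\<in>V. \<forall>y\<in>V. g y x x = x))"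
    using no_majority[of g] V hom by blast
  have not_mal1: "\<not> ((\<forall>x\<in>V. \<forall>y\<in>V. g x x y = y) \<and> (\<forall>x\<in>V. \<forall>y\<in>V. g y x x = y))"
    using no_maltsev[of g] V hom by blast
  have not_mal2: "\<not> ((\<forall>x\<in>V. \<forall>y\<in>V. g x x y = y) \<and> (\<forall>x\<in>V. \<forall>y\<in>V. g x y x = y))"
    using no_maltsev[of "\<lambda>x y z. g y x z"] V hom by blast
  have not_mal3: "\<not> ((\<forall>x\<in>V. \<forall>y\<in>V. g x y x = y) \<and> (\<forall>x\<in>V. \<forall>y\<in>V. g y x x = y))"
    using no_maltsev[of "\<lambda>x y z. g x z y"] V hom by blast
  consider
      "\<forall>x\<in>V. \<forall>y\<in>V. g x x y = x" "\<forall>x\<in>V. \<forall>y\<in>V. g x y x = x" "\<forall>x\<in>V. \<forall>y\<in>V. g y x x = y"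
    | "\<forall>x\<in>V. \<forall>y\<in>V. g x x y = x" "\<forall>x\<in>V. \<forall>y\<in>V. g x y x = y" "\<forall>x\<in>V. \<forall>y\<in>V. g y x x = x"
    | "\<forall>x\<in>V. \<forall>y\<in>V. g x x y = y" "\<forall>x\<in>V. \<forall>y\<in>V. g x y x = x" "\<forall>x\<in>V. \<forall>y\<in>V. g y x x = x"
    using c01 c02 c12 not_maj not_mal1 not_mal2 not_mal3 by argo
  then show ?thesis
  proof cases
    case 1
    then show ?thesis
      by (intro exI[of _ 0]) (auto simp: coord3 less_3)
  next
    case 2
    then show ?thesis
      by (intro exI[of _ 1]) (auto simp: coord3 less_3)
  next
    case 3
    then show ?thesis
      by (intro exI[of _ 2]) (auto simp: coord3 less_3)
  qed
qed

theorem projective_if_binary_projective: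
  assumes binary: "\<And>f. \<lbrakk>polymorphism H 2 f; idempotent H 2 f\<rbrakk> \<Longrightarrow> is_projection H 2 f"
  shows "projective H"
proof -
  have "is_projection H m f" if "1 \<le> m" "polymorphism H m f" "idempotent H m f" for m f
    using that
  proof (induction m arbitrary: f)
    case (Suc m)
    consider "m = 0" | "m = 1" | "2 \<le> m" by linarith
    then show ?case
    proof cases
      case 1
      \<comment> \<open>A tuple of length 1 is constant, so idempotence settles arity 1.\<close>
      have "xs = replicate 1 (xs ! 0)" if "length xs = 1" for xs :: "'a list"
        using that by (auto simp: length_Suc_conv)
      then have "f xs = xs ! 0" if "length xs = 1" "xs ! 0 \<in> V" for xs
        using Suc.prems(3) that 1 unfolding idempotent_def by (metis One_nat_def)
      then show ?thesis using 1 by (auto simp: is_projection_def power_verts_iff)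
    next
      case 2
      then show ?thesis using binary Suc.prems by (simp add: numeral_2_eq_2)
    next
      case 3
      have IH: "is_projection H m g" if "polymorphism H m g" "idempotent H m g" for g
        using Suc.IH 3 that by simp
      have ex: "\<exists>k. coord (Suc m) f i j k" if "i < Suc m" "j < Suc m" "i \<noteq> j" for i j
        using IH Suc.prems(2,3) that by (rule identify_variables)
      have "\<exists>k<Suc m. \<forall>i<Suc m. \<forall>j<Suc m. i \<noteq> j \<longrightarrow> coord (Suc m) f i j k"
      \<comment> \<open>Arity 3 is separate because two disjoint pairs of positions need four
        variables.\<close>
      proof (cases "m = 2")
        case True
        then have "Suc m = 3" by simp
        then show ?thesis using ternary_common_coordinate[of f] ex Suc.prems(2) by simp
      next
        case False
        then show ?thesis using common_coordinate[of "Suc m" f] ex 3 by simp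
      qed
      then show ?thesis
        using semiprojection_imp_projection[OF Suc.prems(2)] 3 by auto
    qed
  qed simp
  then show ?thesis by (simp add: projective_def)
qed

section \<open>Indecomposability of small cores\<close>

lemma indecomposable_if_card_less_9:
  assumes "card V < 9"
  shows "indecomposable H"
proof
  assume "decomposable H"
  then obtain H1 H2 :: "nat pair_pre_digraph" where
    G: "pair_graph H1" "pair_graph H2" "nontrivial H1" "nontrivial H2"
    and iso: "digraph_iso (with_proj H) (with_proj (cross_prod H1 H2))"
    by (auto simp: decomposable_def)
  have wf: "pair_wf_digraph H" by unfold_locales
  obtain h where h: "inj_on h V" "pverts (cross_prod H1 H2) = h ` V"
    "parcs (cross_prod H1 H2) = map_prod h h ` E"
    using iso[unfolded pair_digraph_iso_iff[OF wf]] by blast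
  \<comment> \<open>A homomorphism to a loopless graph on two vertices is a proper two-colouring; it
    will be applied to the coordinate maps of the product.\<close>
  have no_two: False
    if K: "pair_graph K" "card (pverts K) = 2"
      and c: "\<And>u v. (u, v) \<in> E \<Longrightarrow> (c u, c v) \<in> parcs K" for K :: "nat pair_pre_digraph" and c
  proof -
    interpret K: pair_graph K by fact
    obtain p q where pq: "pverts K = {p, q}" using K(2) by (auto simp: card_2_iff)
    have two: "c u \<in> {p, q} \<and> c v \<in> {p, q} \<and> c u \<noteq> c v" if "(u, v) \<in> E" for u v
      using c[OF that] K.no_loops[of "(c u, c v)"] K.in_arcsD1 K.in_arcsD2 pq by fastforce
    have "(c u = p) \<noteq> (c v = p)" if "(u, v) \<in> E" for u v
      using two[OF that] by auto
    then show False by (rule not_two_colourable)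
  qed
  have arcs: "(fst (h u), fst (h v)) \<in> parcs H1" "(snd (h u), snd (h v)) \<in> parcs H2"
    if "(u, v) \<in> E" for u v
  proof -
    have "map_prod h h (u, v) \<in> parcs (cross_prod H1 H2)" using that h(3) by blast
    then show "(fst (h u), fst (h v)) \<in> parcs H1" "(snd (h u), snd (h v)) \<in> parcs H2"
      by (auto simp: cross_prod_def)
  qed
  have "card V = card (pverts H1) * card (pverts H2)"
    using h(1,2) by (simp add: card_image flip: card_cartesian_product) (simp add: cross_prod_def card_image)
  \<comment> \<open>Two factors with at least three vertices each would give at least nine.\<close>
  then have "\<not> (3 \<le> card (pverts H1) \<and> 3 \<le> card (pverts H2))"
    using mult_le_mono[of 3 "card (pverts H1)" 3 "card (pverts H2)"] assms by auto
  then have "card (pverts H1) = 2 \<or> card (pverts H2) = 2"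
    using G(3,4) by (auto simp: nontrivial_def)
  then show False
    using no_two[of H1 "\<lambda>u. fst (h u)"] no_two[of H2 "\<lambda>u. snd (h u)"] arcs G(1,2) by blast
qed

section \<open>Transfer between the core and its canonical numbering\<close>

lemma ex_canonical_labelling:
  "\<exists>\<sigma>. bij_betw \<sigma> {..<card V} V \<and> canonical_core (card V) (\<lambda>i j. (\<sigma> i, \<sigma> j) \<in> E)"
proof -
  let ?n = "card V"
  define code where "code \<sigma> = adj_code ?n (\<lambda>i j. (\<sigma> i, \<sigma> j) \<in> E)" for \<sigma>
  define B where "B = {\<sigma>. bij_betw \<sigma> {..<?n} V}"
  \<comment> \<open>The maximum is taken over codes, which have a fixed length, since functions in
    \<open>B\<close> are unconstrained outside \<open>{..<?n}\<close>.\<close>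
  have "code ` B \<subseteq> {bs. set bs \<subseteq> UNIV \<and> length bs = length (vertex_pairs ?n)}"
    by (auto simp: code_def adj_code_def)
  then have fin: "finite (code ` B)"
    by (rule finite_subset) (rule finite_lists_length_eq, simp)
  have "B \<noteq> {}"
    using ex_bij_betw_nat_finite[OF pair_finite_verts] by (auto simp: B_def atLeast0LessThan)
  then have "Max (code ` B) \<in> code ` B" using fin by (intro Max_in) auto
  then obtain \<sigma> where max: "Max (code ` B) = code \<sigma>" and "\<sigma> \<in> B" by (rule imageE)
  then have bij: "bij_betw \<sigma> {..<?n} V" by (simp add: B_def)
  define \<tau> where "\<tau> = inv_into {..<?n} \<sigma>"
  have bij': "bij_betw \<tau> V {..<?n}"
    unfolding \<tau>_def using bij by (rule bij_betw_inv_into)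
  have \<sigma>\<tau>: "\<sigma> (\<tau> u) = u" if "u \<in> V" for u
    using bij that by (auto simp: \<tau>_def bij_betw_inv_into_right)
  have \<tau>: "\<tau> u < ?n" if "u \<in> V" for u
    using bij' that by (auto dest: bij_betwE)
  have \<sigma>: "\<sigma> i \<in> V" if "i < ?n" for i
    using bij that by (auto dest: bij_betwE)
  have "canonical_core ?n (\<lambda>i j. (\<sigma> i, \<sigma> j) \<in> E)"
  proof
    fix f assume f: "\<And>i. i < ?n \<Longrightarrow> f i < ?n"
      "\<And>i j. \<lbrakk>i < ?n; j < ?n; (\<sigma> i, \<sigma> j) \<in> E\<rbrakk> \<Longrightarrow> (\<sigma> (f i), \<sigma> (f j)) \<in> E"
    \<comment> \<open>Conjugation by the numbering turns \<open>f\<close> into an endomorphism of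
      \<open>H\<close>.\<close>
    have "bij_betw (\<lambda>u. \<sigma> (f (\<tau> u))) V V"
      using f \<sigma>\<tau> \<tau> \<sigma> arc_verts by (intro endo_bij) auto
    then have "inj_on (\<lambda>u. \<sigma> (f (\<tau> u))) V"
      by (rule bij_betw_imp_inj_on)
    then have "inj_on (f \<circ> \<tau>) V"
      by (simp add: inj_on_def)
    then have "inj_on f (\<tau> ` V)"
      by (rule inj_on_imageI)
    then show "inj_on f {..<?n}"
      using bij' by (simp add: bij_betw_def)
  next
    fix p assume "bij_betw p {..<?n} {..<?n}"
    then have "\<sigma> \<circ> p \<in> B" using bij by (auto simp: B_def intro: bij_betw_trans)
    then have "code (\<sigma> \<circ> p) \<le> code \<sigma>" unfolding max[symmetric] by (intro Max_ge fin) auto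
    then show "adj_code ?n (\<lambda>i j. (\<sigma> (p i), \<sigma> (p j)) \<in> E) \<le> adj_code ?n (\<lambda>i j. (\<sigma> i, \<sigma> j) \<in> E)"
      by (simp add: code_def)
  qed (use arc_sym arc_irrefl in auto)
  with bij show ?thesis by blast
qed

lemma projective_if_check_core:
  assumes "check_core (card V) c [] []"
  shows "projective H"
proof (rule projective_if_binary_projective)
  fix f assume f: "polymorphism H 2 f" "idempotent H 2 f"
  let ?n = "card V"
  obtain \<sigma> where bij: "bij_betw \<sigma> {..<?n} V"
    and canon: "canonical_core ?n (\<lambda>i j. (\<sigma> i, \<sigma> j) \<in> E)"
    using ex_canonical_labelling by blast
  interpret canonical_core ?n "\<lambda>i j. (\<sigma> i, \<sigma> j) \<in> E" by fact
  define \<tau> where "\<tau> = inv_into {..<?n} \<sigma>"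
  have \<sigma>\<tau>: "\<sigma> (\<tau> u) = u" if "u \<in> V" for u
    using bij that by (auto simp: \<tau>_def bij_betw_inv_into_right)
  have \<tau>\<sigma>: "\<tau> (\<sigma> i) = i" if "i < ?n" for i
    using bij that by (auto simp: \<tau>_def bij_betw_inv_into_left)
  have \<tau>: "\<tau> u < ?n" if "u \<in> V" for u
    using bij_betw_inv_into[OF bij] that by (auto simp: \<tau>_def dest: bij_betwE)
  have \<sigma>: "\<sigma> i \<in> V" if "i < ?n" for i
    using bij that by (auto dest: bij_betwE)
  have all2: "(\<forall>t<2. P t) \<longleftrightarrow> P 0 \<and> P 1" for P :: "nat \<Rightarrow> bool"
    by (auto simp: less_2_cases_iff)
  have fV: "f [u, v] \<in> V" if "u \<in> V" "v \<in> V" for u v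
    using f(1) that by (simp add: polymorphism_iff all2)
  have hom: "(f [u, v], f [u', v']) \<in> E" if "(u, u') \<in> E" "(v, v') \<in> E" for u v u' v'
    using f(1) that by (simp add: polymorphism_iff all2)
  have idem: "f [u, u] = u" if "u \<in> V" for u
    using f(2) that by (simp add: idempotent_def numeral_2_eq_2)
  \<comment> \<open>The polymorphism read on indices, to which \<open>binary_rigid\<close>
    applies.\<close>
  define F where "F x y = \<tau> (f [\<sigma> x, \<sigma> y])" for x y
  have binary_rigid
    using check_core_sound[OF assms] by (simp add: consistent_def)
  then have "(\<forall>x<?n. \<forall>y<?n. F x y = x) \<or> (\<forall>x<?n. \<forall>y<?n. F x y = y)"
    unfolding binary_rigid_def
    by (rule allE[of _ F], elim impE) (auto simp: F_def \<tau> \<sigma> fV idem \<tau>\<sigma> \<sigma>\<tau> hom)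
  moreover have "f [u, v] = \<sigma> (F (\<tau> u) (\<tau> v))" if "u \<in> V" "v \<in> V" for u v
    using that by (simp add: F_def \<sigma>\<tau> fV)
  ultimately have "(\<forall>u\<in>V. \<forall>v\<in>V. f [u, v] = u) \<or> (\<forall>u\<in>V. \<forall>v\<in>V. f [u, v] = v)"
    using \<tau> \<sigma>\<tau> by auto
  moreover have "xs = [xs ! 0, xs ! 1]" if "length xs = 2" for xs :: "'a list"
    using that by (auto simp: numeral_2_eq_2 length_Suc_conv)
  ultimately have "(\<forall>xs. length xs = 2 \<and> xs ! 0 \<in> V \<and> xs ! 1 \<in> V \<longrightarrow> f xs = xs ! 0) \<or>
      (\<forall>xs. length xs = 2 \<and> xs ! 0 \<in> V \<and> xs ! 1 \<in> V \<longrightarrow> f xs = xs ! 1)"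
    by metis
  then show "is_projection H 2 f"
    unfolding is_projection_def Ball_def power_verts_iff all2
    by (metis pos2 one_less_numeral_iff semiring_norm(76))
qed

end

theorem theorem5p1:
  fixes H :: "'a pair_pre_digraph"
  assumes "pair_graph H"
    and "connected (with_proj H)"
    and "nontrivial H"
    and "is_core H"
    and "3 \<le> card (pverts H)" and "card (pverts H) \<le> 7"
  shows "projective H \<longleftrightarrow> indecomposable H"
proof -
  interpret connected_core H
    using assms by (simp add: connected_core_def connected_core_axioms_def)
  have "card V \<in> {3, 4, 5, 6, 7}" using assms(5,6) by auto
  then have "\<exists>c. check_core (card V) c [] []"
    using check_cores3 check_cores4 check_cores5 check_cores6 check_cores7 by auto
  \<comment> \<open>Both sides of the equivalence hold for every graph in this range.\<close>
  then have "projective H" using projective_if_check_core by blast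
  moreover have "indecomposable H" using assms(6) by (intro indecomposable_if_card_less_9) simp
  ultimately show ?thesis by simp
qed

end
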